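(* Let $\mathbb{F}$ be a field, $V$ an $\mathbb{F}$-vector space of dimension $n$, and $r=2s$ an even integer with $0\le r\le n$. Assume that $|\mathbb{F}| \geq n-1$ if $n$ is even, and $|\mathbb{F}| \geq n-2$ if $n$ is odd. Then the greatest possible dimension $d_r^{\geq}(V)$ of an affine subspace of $\mathcal{A}^2(V)$ in which every form has rank at least $r$ satisfies $$d_r^{\geq}(V) = s(s-1) + r(n-r) + \frac{(n-r)(n-r-1)}{2} = \dim \mathcal{A}^2(V) - s^2.$$
   Context: $\mathcal{A}^2(V)$ denotes the vector space of all alternating bilinear forms on $V$ (bilinear forms $b$ with $b(x,x)=0$ for all $x\in V$). The field may have any characteristic, including 2. *)

theory Defs
  imports Main "HOL.Vector_Spaces" "HOL-Library.Function_Algebras"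
begin

text \<open>Abstract setting: V is the carrier type 'v, a vector space over the field 'a
  with scalar multiplication scale.  Bilinear forms on V are functions 'v => 'v => 'a;
  they form an 'a-vector space under pointwise operations (form_scale).\<close>

definition bilinear_form :: "('a::field \<Rightarrow> 'v::ab_group_add \<Rightarrow> 'v) \<Rightarrow> ('v \<Rightarrow> 'v \<Rightarrow> 'a) \<Rightarrow> bool" where
  "bilinear_form scale b \<longleftrightarrow>
     (\<forall>x x' y. b (x + x') y = b x y + b x' y) \<and>
     (\<forall>c x y. b (scale c x) y = c * b x y) \<and>
     (\<forall>x y y'. b x (y + y') = b x y + b x y') \<and>
     (\<forall>c x y. b x (scale c y) = c * b x y)"

definition alt_forms :: "('a::field \<Rightarrow> 'v::ab_group_add \<Rightarrow> 'v) \<Rightarrow> ('v \<Rightarrow> 'v \<Rightarrow> 'a) set" where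
  "alt_forms scale = {b. bilinear_form scale b \<and> (\<forall>x. b x x = 0)}"

definition form_scale :: "'a::field \<Rightarrow> ('v \<Rightarrow> 'v \<Rightarrow> 'a) \<Rightarrow> ('v \<Rightarrow> 'v \<Rightarrow> 'a)" where
  "form_scale c b = (\<lambda>x y. c * b x y)"

definition form_rank :: "('a::field \<Rightarrow> 'v::ab_group_add \<Rightarrow> 'v) \<Rightarrow> ('v \<Rightarrow> 'v \<Rightarrow> 'a) \<Rightarrow> nat" where
  "form_rank scale b =
     vector_space.dim scale (UNIV :: 'v set) - vector_space.dim scale {x. \<forall>y. b x y = 0}"

definition affine_translate :: "('v \<Rightarrow> 'v \<Rightarrow> 'a::field) \<Rightarrow> ('v \<Rightarrow> 'v \<Rightarrow> 'a) set \<Rightarrow> ('v \<Rightarrow> 'v \<Rightarrow> 'a) set" where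
  "affine_translate b0 W = (\<lambda>w. b0 + w) ` W"

definition d_rank_ge :: "('a::field \<Rightarrow> 'v::ab_group_add \<Rightarrow> 'v) \<Rightarrow> nat \<Rightarrow> nat" where
  "d_rank_ge scale r =
     (GREATEST d. \<exists>b0 W. b0 \<in> alt_forms scale \<and> W \<subseteq> alt_forms scale \<and>
        module.subspace form_scale W \<and> vector_space.dim form_scale W = d \<and>
        (\<forall>b \<in> affine_translate b0 W. r \<le> form_rank scale b))"

end

theory Submission
  imports Defs
begin

text \<open>Upper bound. If some form of the affine space \<open>b + K\<close> has a nonzero vector \<open>x\<close> in its
  radical, pass to a complement of \<open>x\<close> and to the forms of \<open>K\<close> that vanish on \<open>x\<close>; this costs at
  most \<open>n - 1\<close> dimensions and keeps the ranks. So assume that all forms are nondegenerate, \<open>n = 2m\<close>,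
  take any \<open>x \<noteq> 0\<close> and \<open>y\<close> with \<open>b(x, y) = 1\<close>, and restrict the forms \<open>w \<in> K\<close> with \<open>w(x, -) = 0\<close> to
  \<open>{x, y}\<^sup>\<bottom>\<close>, where all \<open>b + w\<close> are again nondegenerate. What is lost is the space \<open>A\<close> of
  the \<open>a\<close> with \<open>b(a, -) = w(x, -)\<close> for some \<open>w \<in> K\<close>, and the space \<open>B\<close> of the \<open>z\<close> with
  \<open>b(x, -) \<and> b(z, -) \<in> K\<close>, taken modulo \<open>x\<close>. The spaces \<open>A + \<langle>x\<rangle>\<close> and \<open>B + \<langle>x\<rangle>\<close> are
  \<open>b\<close>-orthogonal, so \<open>dim A + dim B \<le> n - 2\<close>, and \<open>dim K \<le> m(m - 1)\<close> follows by induction.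

  For \<open>A \<bottom> B\<close>, let \<open>u\<close> be the endomorphism with \<open>b(u p, q) = w(p, q)\<close>. Nondegeneracy of
  \<open>b + \<lambda>w + t b(x, -) \<and> b(z, -)\<close> for all \<open>t\<close> says that \<open>z\<close> is orthogonal to the resolvent vectors
  \<open>x\<^sub>\<lambda> = (1 + \<lambda>u)\<^sup>-\<^sup>1 x\<close>. These lie in the cyclic space of \<open>x\<close>, which is totally isotropic and so has
  dimension at most \<open>m\<close>; hence \<open>m\<close> scalars suffice for \<open>u x\<close> to be a combination of the \<open>x\<^sub>\<lambda>\<close>.

  Lower bound. In a basis, prescribe \<open>1\<close> on the antidiagonal and \<open>0\<close> below it in the leading
  \<open>2s \<times> 2s\<close> block; this imposes \<open>s\<^sup>2\<close> conditions.\<close>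

section \<open>Alternating forms as elements of a vector space\<close>

interpretation forms: vector_space
  "form_scale :: 'a::field \<Rightarrow> ('v \<Rightarrow> 'v \<Rightarrow> 'a) \<Rightarrow> ('v \<Rightarrow> 'v \<Rightarrow> 'a)"
  by standard (auto simp: form_scale_def fun_eq_iff algebra_simps)

lemma form_scale_apply: "form_scale c b x y = c * b x y"
  by (simp add: form_scale_def)

text \<open>Nondegeneracy is relative to a subset of the fixed carrier, so that the inductions can
  pass to smaller subspaces without changing the type or the forms.\<close>

definition nondegenerate_on :: "'v::zero set \<Rightarrow> ('v \<Rightarrow> 'v \<Rightarrow> 'a::zero) \<Rightarrow> bool" where
  "nondegenerate_on S b \<longleftrightarrow> (\<forall>x\<in>S. (\<forall>y\<in>S. b x y = 0) \<longrightarrow> x = 0)"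

context vector_space
begin

lemma
  assumes "b \<in> alt_forms scale"
  shows alt_add_left: "b (x + x') y = b x y + b x' y"
    and alt_scale_left: "b (scale c x) y = c * b x y"
    and alt_add_right: "b x (y + y') = b x y + b x y'"
    and alt_scale_right: "b x (scale c y) = c * b x y"
    and alt_self: "b x x = 0"
  using assms by (auto simp: alt_forms_def bilinear_form_def)

lemma alt_zero_left: "b \<in> alt_forms scale \<Longrightarrow> b 0 y = 0"
  using alt_scale_left[of b 0 0 y] by simp

lemma alt_zero_right: "b \<in> alt_forms scale \<Longrightarrow> b x 0 = 0"
  using alt_scale_right[of b x 0 0] by simp

lemma alt_uminus_left: "b \<in> alt_forms scale \<Longrightarrow> b (- x) y = - b x y"
  using alt_scale_left[of b "-1" x y] by simp

lemma alt_uminus_right: "b \<in> alt_forms scale \<Longrightarrow> b x (- y) = - b x y"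
  using alt_scale_right[of b x "-1" y] by simp

lemma alt_diff_left: "b \<in> alt_forms scale \<Longrightarrow> b (x - x') y = b x y - b x' y"
  using alt_add_left[of b x "- x'" y] by (simp add: alt_uminus_left)

lemma alt_diff_right: "b \<in> alt_forms scale \<Longrightarrow> b x (y - y') = b x y - b x y'"
  using alt_add_right[of b x y "- y'"] by (simp add: alt_uminus_right)

lemma alt_swap: "b \<in> alt_forms scale \<Longrightarrow> b y x = - b x y"
  using alt_self[of b "x + y"]
  by (simp add: alt_add_left alt_add_right alt_self eq_neg_iff_add_eq_0 add.commute)

lemma alt_sum_left: "b \<in> alt_forms scale \<Longrightarrow> b (sum f A) y = (\<Sum>i\<in>A. b (f i) y)"
  by (induction A rule: infinite_finite_induct) (simp_all add: alt_zero_left alt_add_left)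

lemmas alt_simps = alt_add_left alt_add_right alt_scale_left alt_scale_right
  alt_zero_left alt_zero_right alt_diff_left alt_diff_right alt_self

lemma subspace_alt_forms: "forms.subspace (alt_forms scale)"
  by (rule forms.subspaceI) (auto simp: alt_forms_def bilinear_form_def form_scale_apply algebra_simps)

lemma alt_forms_add: "b \<in> alt_forms scale \<Longrightarrow> c \<in> alt_forms scale \<Longrightarrow> b + c \<in> alt_forms scale"
  by (rule forms.subspace_add[OF subspace_alt_forms])

lemma subspace_left_orthogonal:
  assumes "b \<in> alt_forms scale"
  shows "subspace {x. \<forall>y\<in>S. b x y = 0}"
  by (rule subspaceI) (auto simp: alt_simps[OF assms])

lemma nondegenerate_on_eqI:
  assumes "subspace S" "nondegenerate_on S b" "b \<in> alt_forms scale" "x \<in> S" "y \<in> S"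
    and "\<And>z. z \<in> S \<Longrightarrow> b x z = b y z"
  shows "x = y"
proof -
  have "x - y \<in> S" by (simp add: assms subspace_diff)
  moreover have "\<forall>z\<in>S. b (x - y) z = 0" by (simp add: assms alt_diff_left)
  ultimately show ?thesis using assms(2) unfolding nondegenerate_on_def by fastforce
qed

text \<open>Relations are taken over indices, so a repetition \<open>f i = f j\<close> is itself a
  nontrivial relation. Injectivity is what allows the resolvent vectors to be counted by their
  scalars.\<close>

lemma independent_image_if_indexed:
  assumes "finite M"
    and indep: "\<And>c. (\<Sum>i\<in>M. scale (c i) (f i)) = 0 \<Longrightarrow> \<forall>i\<in>M. c i = 0"
  shows "inj_on f M" "independent (f ` M)"
proof -
  show inj: "inj_on f M"
  proof (rule inj_onI, rule ccontr)
    fix i j assume ij: "i \<in> M" "j \<in> M" "f i = f j" "i \<noteq> j"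
    define c :: "_ \<Rightarrow> 'a" where "c = (\<lambda>k. if k = i then 1 else if k = j then -1 else 0)"
    have "(\<Sum>k\<in>M. scale (c k) (f k)) = (\<Sum>k\<in>{i,j}. scale (c k) (f k))"
      using assms(1) ij by (intro sum.mono_neutral_right) (auto simp: c_def)
    also have "\<dots> = 0" using ij by (simp add: c_def)
    finally have "c i = 0" using indep ij by blast
    then show False by (simp add: c_def)
  qed
  show "independent (f ` M)"
  proof
    assume "dependent (f ` M)"
    then obtain u where u: "\<exists>v\<in>f ` M. u v \<noteq> 0" "(\<Sum>v\<in>f ` M. scale (u v) v) = 0"
      using dependent_finite[of "f ` M"] assms(1) by auto
    have "(\<Sum>i\<in>M. scale ((u \<circ> f) i) (f i)) = 0"
      using u(2) by (simp add: sum.reindex[OF inj])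
    from indep[OF this] u(1) show False by auto
  qed
qed

end

section \<open>Duality under a nondegenerate form, and rank-nullity for spaces of forms\<close>

context finite_dimensional_vector_space
begin

text \<open>Identifies functionals on the span of a basis \<open>E\<close> with vectors, so that no dual space is
  needed.\<close>

lemma coordinate_map:
  assumes "b \<in> alt_forms scale" "finite E"
  shows "Vector_Spaces.linear scale scale (\<lambda>z. \<Sum>e\<in>E. scale (b e z) e)"
  by unfold_locales
    (simp_all add: alt_simps[OF assms(1)] scale_left_distrib sum.distrib scale_sum_right)

lemma nondegenerate_on_eq_zero_if_basis:
  assumes "b \<in> alt_forms scale" "nondegenerate_on (span E) b" "z \<in> span E"
    and "\<And>e. e \<in> E \<Longrightarrow> b e z = 0"
  shows "z = 0"
proof -
  have "b z p = 0" if "p \<in> span E" for p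
    using that
  proof (induction rule: span_induct)
    case base
    show ?case by (rule subspaceI) (auto simp: alt_simps[OF assms(1)])
  next
    case (step e)
    then show ?case using assms(4) alt_swap[OF assms(1), of z e] by simp
  qed
  then show ?thesis using assms(2,3) unfolding nondegenerate_on_def by blast
qed

lemma coordinate_map_inj_on:
  assumes "b \<in> alt_forms scale" "finite E" "independent E" "nondegenerate_on (span E) b"
  shows "inj_on (\<lambda>z. \<Sum>e\<in>E. scale (b e z) e) (span E)"
proof -
  interpret g: linear scale scale "\<lambda>z. \<Sum>e\<in>E. scale (b e z) e"
    by (rule coordinate_map[OF assms(1,2)])
  have "z = 0" if "z \<in> span E" "(\<Sum>e\<in>E. scale (b e z) e) = 0" for z
  proof (rule nondegenerate_on_eq_zero_if_basis[OF assms(1,4) that(1)])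
    fix e assume "e \<in> E"
    then show "b e z = 0"
      using independentD[OF assms(3,2) order.refl that(2)] by blast
  qed
  then show ?thesis
    by (subst g.inj_on_iff_eq_0) auto
qed

text \<open>Extend a basis \<open>D\<close> of \<open>A\<close> to a basis \<open>E\<close> of
  \<open>S\<close>. The coordinate map of \<open>b\<close> is injective on \<open>S\<close>, and for
  vectors of \<open>C\<close> the coordinates along \<open>D\<close> vanish by orthogonality, so
  \<open>C\<close> embeds into the span of \<open>E - D\<close>.\<close>

lemma dim_orthogonal_le:
  assumes S: "subspace S" and b: "b \<in> alt_forms scale" "nondegenerate_on S b"
    and A: "A \<subseteq> S" and C: "C \<subseteq> S"
    and orth: "\<And>a c. a \<in> A \<Longrightarrow> c \<in> C \<Longrightarrow> b a c = 0"
  shows "dim A + dim C \<le> dim S"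
proof -
  obtain D where D: "D \<subseteq> A" "independent D" "A \<subseteq> span D" "card D = dim A"
    by (rule basis_exists)
  obtain E where E: "D \<subseteq> E" "E \<subseteq> S" "independent E" "S \<subseteq> span E"
    using maximal_independent_subset_extend[of D S] D A by blast
  have fin: "finite E" using E(3) by (rule finiteI_independent)
  have SE: "S = span E" using E S by (metis span_subspace)
  define g where "g = (\<lambda>z. \<Sum>e\<in>E. scale (b e z) e)"
  interpret p: finite_dimensional_vector_space_pair_1 scale Basis scale
    by unfold_locales
  interpret g: linear scale scale g
    unfolding g_def by (rule coordinate_map[OF b(1) fin])
  have sub: "span C \<subseteq> S" using C S by (simp add: span_minimal)
  have "inj_on g (span C)"
    using coordinate_map_inj_on[OF b(1) fin E(3)] b(2) sub inj_on_subset
    unfolding g_def SE by blast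
  then have "dim C = dim (g ` C)"
    by (metis p.dim_image_eq g.linear_axioms)
  also have "g ` C \<subseteq> span (E - D)"
  proof clarify
    fix c assume "c \<in> C"
    then have "g c = (\<Sum>e\<in>E - D. scale (b e c) e)"
      unfolding g_def using fin E(1) D(1) orth by (intro sum.mono_neutral_right) auto
    also have "\<dots> \<in> span (E - D)"
      by (intro span_sum span_scale span_base)
    finally show "g c \<in> span (E - D)" .
  qed
  then have "dim (g ` C) \<le> card (E - D)"
    by (intro dim_le_card) (use fin in auto)
  also have "card (E - D) = dim S - dim A"
    using E D fin SE by (simp add: card_Diff_subset finite_subset dim_eq_card_independent)
  finally have "dim C \<le> dim S - dim A" .
  moreover have "dim A \<le> dim S" using A by (rule dim_subset)
  ultimately show ?thesis by linarith
qed

text \<open>The coordinate map of \<open>b\<close> is an injective endomorphism of \<open>S\<close>,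
  hence onto; a preimage of the coordinate vector of the functional represents it.\<close>

lemma functional_representation:
  assumes S: "subspace S" and b: "b \<in> alt_forms scale" "nondegenerate_on S b"
    and v: "v \<in> alt_forms scale"
  shows "\<exists>z\<in>S. \<forall>q\<in>S. b z q = v p q"
proof -
  obtain E where E: "finite E" "E \<subseteq> S" "independent E" "span E = S"
    using basis_subspace_exists[OF S] by metis
  define g where "g = (\<lambda>z. \<Sum>e\<in>E. scale (b e z) e)"
  interpret pp: finite_dimensional_vector_space_pair_1 scale Basis scale
    by unfold_locales
  interpret g: linear scale scale g
    unfolding g_def by (rule coordinate_map[OF b(1) E(1)])
  have inj: "inj_on g (span E)"
    using coordinate_map_inj_on[OF b(1) E(1,3)] b(2) unfolding g_def E(4) by blast
  have sub: "g ` S \<subseteq> S"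
    unfolding g_def using E(2) S by (auto intro!: subspace_sum subspace_scale)
  have "dim (g ` S) = dim S"
    by (metis pp.dim_image_eq g.linear_axioms inj E(4) span_span)
  then have surj: "g ` S = S"
    using subspace_dim_equal[OF g.subspace_image[OF S] S sub] by simp
  \<comment> \<open>Both \<open>v e p\<close> and the coordinates \<open>b e z\<close> have their
    arguments reversed, so the two signs cancel in the end.\<close>
  have "(\<Sum>e\<in>E. scale (v e p) e) \<in> S"
    using E(2) S by (auto intro!: subspace_sum subspace_scale)
  then obtain z where z: "z \<in> S" "(\<Sum>e\<in>E. scale (v e p) e) = g z"
    using surj by blast
  have e: "b z e = v p e" if "e \<in> E" for e
  proof -
    have "(\<Sum>e\<in>E. scale (b e z - v e p) e) = 0"
      using z(2) unfolding g_def by (simp add: scale_left_diff_distrib sum_subtractf)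
    from independentD[OF E(3,1) order.refl this that]
    show ?thesis using alt_swap[OF b(1), of z e] alt_swap[OF v, of p e] by simp
  qed
  have "b z q = v p q" if "q \<in> span E" for q
    using that
  proof (induction rule: span_induct)
    case base
    show ?case by (rule subspaceI) (auto simp: alt_simps[OF b(1)] alt_simps[OF v])
  next
    case (step q)
    then show ?case by (rule e)
  qed
  then show ?thesis using z(1) E(4) by blast
qed

text \<open>Rank-nullity for a map linear on \<open>K\<close>: lifts of a basis of the image,
  together with the kernel, span \<open>K\<close>. It is phrased with finite spanning sets because
  the functions \<open>'v => 'v => 'a\<close> need not form a finite-dimensional space; later bounds
  on spaces of forms have the same shape.\<close>

lemma subspace_subset_span_lift:
  assumes K: "forms.subspace K"
    and add: "\<And>w w'. w \<in> K \<Longrightarrow> w' \<in> K \<Longrightarrow> f (w + w') = f w + f w'"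
    and scale: "\<And>c w. w \<in> K \<Longrightarrow> f (form_scale c w) = scale c (f w)"
  obtains C where "finite C" "card C \<le> dim (f ` K)"
    "K \<subseteq> forms.span (C \<union> {w \<in> K. f w = 0})"
proof -
  obtain B where B: "B \<subseteq> f ` K" "independent B" "f ` K \<subseteq> span B" "card B = dim (f ` K)"
    by (rule basis_exists)
  obtain h where h: "\<And>b. b \<in> B \<Longrightarrow> h b \<in> K \<and> f (h b) = b"
    using B(1) by (metis subset_eq image_iff)
  have fin: "finite B" using B(2) by (rule finiteI_independent)
  have f0: "f 0 = 0"
    using scale[OF forms.subspace_0[OF K], of 0] by simp
  have lift: "\<exists>w \<in> K \<inter> forms.span (h ` B). f w = v" if "v \<in> span B" for v
    using that
  proof (induction rule: span_induct)
    case base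
    show ?case
    proof (rule subspaceI, goal_cases)
      case 1
      then show ?case
        using f0 forms.subspace_0[OF K] forms.span_zero by (auto intro!: bexI[of _ 0])
    next
      case (2 x y)
      then obtain w w' where "w \<in> K \<inter> forms.span (h ` B)" "f w = x"
        "w' \<in> K \<inter> forms.span (h ` B)" "f w' = y" by auto
      then show ?case
        by (auto intro!: bexI[of _ "w + w'"] forms.span_add forms.subspace_add[OF K] simp: add)
    next
      case (3 c x)
      then obtain w where "w \<in> K \<inter> forms.span (h ` B)" "f w = x" by auto
      then show ?case
        by (auto intro!: bexI[of _ "form_scale c w"] forms.span_scale forms.subspace_scale[OF K]
            simp: scale)
    qed
  next
    case (step v)
    then show ?case using h[OF step] by (auto intro!: bexI[of _ "h v"] forms.span_base)
  qed
  have "w \<in> forms.span (h ` B \<union> {w \<in> K. f w = 0})" if w: "w \<in> K" for w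
  proof -
    obtain w' where w': "w' \<in> K" "w' \<in> forms.span (h ` B)" "f w' = f w"
      using lift B(3) w by (metis IntE imageI subsetD)
    have wK: "w - w' \<in> K" using w w' by (simp add: forms.subspace_diff[OF K])
    have "f w = f (w - w') + f w'" using add[OF wK w'(1)] by simp
    then have "w - w' \<in> {w \<in> K. f w = 0}" using w' wK by simp
    then have "w - w' \<in> forms.span (h ` B \<union> {w \<in> K. f w = 0})"
      by (intro forms.span_base) blast
    moreover have "w' \<in> forms.span (h ` B \<union> {w \<in> K. f w = 0})"
      using w'(2) forms.span_mono[of "h ` B" "h ` B \<union> {w \<in> K. f w = 0}"] by blast
    ultimately have "(w - w') + w' \<in> forms.span (h ` B \<union> {w \<in> K. f w = 0})"
      by (rule forms.span_add)
    then show ?thesis by simp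
  qed
  moreover have "card (h ` B) \<le> dim (f ` K)" using card_image_le[OF fin] B(4) by metis
  ultimately show ?thesis using that[of "h ` B"] fin by blast
qed

section \<open>Resolvent vectors and the orthogonality of \<open>A\<close> and
  \<open>B\<close>\<close>

text \<open>In terms of the endomorphism \<open>u\<close> with \<open>b (u p) q = w p q\<close>, the
  vector \<open>a\<close> is \<open>u x\<close>, and \<open>X l\<close> solves
  \<open>(1 + l u) (X l) = x\<close>. If \<open>a\<close> were outside the span of \<open>x\<close>
  and the \<open>X l\<close>, all these vectors would be independent and pairwise orthogonal, and
  \<open>dim_orthogonal_le\<close>, applied to them twice, would give
  \<open>2 * (card M + 2) \<le> dim S\<close>.\<close>

lemma resolvent_orthogonal:
  assumes S: "subspace S" and b: "b \<in> alt_forms scale" "nondegenerate_on S b"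
    and w: "w \<in> alt_forms scale"
    and M: "finite M" "0 \<notin> M" "dim S < 2 * (card M + 2)"
    and x: "x \<in> S" and a: "a \<in> S" "\<And>q. q \<in> S \<Longrightarrow> b a q = w x q"
    and X: "\<And>l. l \<in> M \<Longrightarrow> X l \<in> S" "\<And>l q. l \<in> M \<Longrightarrow> q \<in> S \<Longrightarrow> b (X l) q + l * w (X l) q = b x q"
    and z: "b x z = 0" "\<And>l. l \<in> M \<Longrightarrow> b (X l) z = 0"
  shows "b a z = 0"
proof (cases "a \<in> span (insert x (X ` M))")
  case True
  then show ?thesis
  proof (induction rule: span_induct)
    case base
    show ?case by (rule subspaceI) (auto simp: alt_simps[OF b(1)])
  next
    case (step v)
    then show ?case using z by auto
  qed
next
  case False
  let ?T = "span (insert x (X ` M))"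
  note eqI = nondegenerate_on_eqI[OF S b(2,1)]
  have TS: "?T \<subseteq> S" using S x X(1) by (intro span_minimal) auto
  \<comment> \<open>The endomorphism \<open>u\<close> maps the span of the \<open>X l\<close> into
    \<open>?T\<close>, because \<open>u (X l) = (x - X l) / l\<close>.\<close>
  have img: "\<exists>t\<in>?T. \<forall>q\<in>S. w v q = b t q" if "v \<in> span (X ` M)" for v
    using that
  proof (induction rule: span_induct)
    case base
    show ?case
    proof (rule subspaceI, goal_cases)
      case 1
      show ?case
        using span_zero by (auto simp: alt_zero_left[OF w] alt_zero_left[OF b(1)] intro!: bexI[of _ 0])
    next
      case (2 u v)
      then obtain t t' where "t \<in> ?T" "\<forall>q\<in>S. w u q = b t q" "t' \<in> ?T" "\<forall>q\<in>S. w v q = b t' q"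
        by auto
      then show ?case
        by (auto intro!: bexI[of _ "t + t'"] span_add simp: alt_add_left[OF w] alt_add_left[OF b(1)])
    next
      case (3 c u)
      then obtain t where "t \<in> ?T" "\<forall>q\<in>S. w u q = b t q"
        by auto
      then show ?case
        by (auto intro!: bexI[of _ "scale c t"] span_scale
            simp: alt_scale_left[OF w] alt_scale_left[OF b(1)])
    qed
  next
    case (step v)
    then obtain l where l: "l \<in> M" "v = X l" by blast
    then have "l \<noteq> 0" using M by blast
    then have "\<forall>q\<in>S. w v q = b (scale (1 / l) (x - v)) q"
      using X(2)[OF l(1), symmetric] l(2) by (simp add: alt_simps[OF b(1)] field_simps)
    moreover have "scale (1 / l) (x - v) \<in> ?T"
      using step by (intro span_scale span_diff span_base) auto
    ultimately show ?case by blast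
  qed
  \<comment> \<open>Otherwise \<open>a = u x\<close> would lie in \<open>?T\<close>.\<close>
  have xT: "x \<notin> span (X ` M)"
  proof
    assume "x \<in> span (X ` M)"
    from img[OF this] obtain t where t: "t \<in> ?T" "\<forall>q\<in>S. w x q = b t q" by blast
    then have "a = t" using a TS by (intro eqI) auto
    then show False using t False by simp
  qed
  have x0: "x \<noteq> 0" using xT span_zero by blast
  have X0: "X l \<noteq> 0" if "l \<in> M" for l
  proof
    assume "X l = 0"
    then have "x = 0"
      using X(2)[OF that] S x
      by (intro eqI) (auto simp: alt_zero_left[OF w] alt_zero_left[OF b(1)] subspace_0)
    then show False using x0 by simp
  qed
  \<comment> \<open>Apply \<open>m u\<close> to a relation among the \<open>X l\<close> with
    \<open>l\<close> in \<open>insert m N\<close>: the result is \<open>?e = 0\<close>. Adding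
    \<open>?e\<close> to the relation cancels \<open>X m\<close> and leaves a multiple of
    \<open>x\<close> plus the terms \<open>c l * (1 - m / l)\<close> at \<open>X l\<close>. By
    \<open>xT\<close> the multiple is zero, and since \<open>l \<noteq> m\<close> the induction
    hypothesis gives \<open>c l = 0\<close>.\<close>
  have indexed: "\<forall>l\<in>N. c l = 0" if "N \<subseteq> M" "(\<Sum>l\<in>N. scale (c l) (X l)) = 0" for N c
    using finite_subset[OF that(1) M(1)] that
  proof (induction N arbitrary: c rule: finite_induct)
    case empty
    then show ?case by simp
  next
    case (insert m N)
    have m: "m \<in> M" and N: "N \<subseteq> M" using insert.prems by auto
    have nz: "l \<noteq> 0" if "l \<in> M" for l using that M by blast
    have R: "scale (c m) (X m) + (\<Sum>l\<in>N. scale (c l) (X l)) = 0"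
      using insert by simp
    let ?e = "scale (c m) (x - X m) + (\<Sum>l\<in>N. scale (c l * m / l) (x - X l))"
    have "?e = 0"
    proof (rule eqI)
      show "?e \<in> S"
        using m N X x S by (auto intro!: subspace_add subspace_scale subspace_diff subspace_sum)
      show "0 \<in> S" using S by (rule subspace_0)
      fix q assume q: "q \<in> S"
      have d: "b (x - X l) q = l * w (X l) q" if "l \<in> M" for l
        using X(2)[OF that q] by (simp add: alt_diff_left[OF b(1)] algebra_simps)
      have "b ?e q = c m * (m * w (X m) q) + (\<Sum>l\<in>N. c l * m / l * (l * w (X l) q))"
        using m N by (simp add: alt_add_left[OF b(1)] alt_scale_left[OF b(1)] alt_sum_left[OF b(1)]
            d subset_iff)
      also have "(\<Sum>l\<in>N. c l * m / l * (l * w (X l) q)) = (\<Sum>l\<in>N. m * (c l * w (X l) q))"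
        using N nz by (intro sum.cong) (auto simp: subset_iff)
      also have "c m * (m * w (X m) q) + \<dots> = m * w (scale (c m) (X m) + (\<Sum>l\<in>N. scale (c l) (X l))) q"
        by (simp add: alt_add_left[OF w] alt_scale_left[OF w] alt_sum_left[OF w] sum_distrib_left
            algebra_simps)
      also have "\<dots> = 0" by (simp add: R alt_zero_left[OF w])
      finally show "b ?e q = b 0 q" by (simp add: alt_zero_left[OF b(1)])
    qed
    define k where "k = c m + (\<Sum>l\<in>N. c l * m / l)"
    have "scale k x + (\<Sum>l\<in>N. scale (c l * (1 - m / l)) (X l))
        = ?e + (scale (c m) (X m) + (\<Sum>l\<in>N. scale (c l) (X l)))"
      by (simp add: k_def scale_left_distrib scale_sum_left scale_right_diff_distrib sum_subtractf
          scale_left_diff_distrib algebra_simps)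
    then have E: "scale k x + (\<Sum>l\<in>N. scale (c l * (1 - m / l)) (X l)) = 0"
      using \<open>?e = 0\<close> R by simp
    have sp: "(\<Sum>l\<in>N. scale (c l * (1 - m / l)) (X l)) \<in> span (X ` M)"
      using N by (intro span_sum span_scale span_base) auto
    have "k = 0"
    proof (rule ccontr)
      assume "k \<noteq> 0"
      have "scale k x = - (\<Sum>l\<in>N. scale (c l * (1 - m / l)) (X l))"
        using E by (simp add: eq_neg_iff_add_eq_0)
      then have "scale k x \<in> span (X ` M)" using span_neg[OF sp] by simp
      then have "scale (1 / k) (scale k x) \<in> span (X ` M)" by (rule span_scale)
      then show False using \<open>k \<noteq> 0\<close> xT by simp
    qed
    then have "(\<Sum>l\<in>N. scale (c l * (1 - m / l)) (X l)) = 0" using E by simp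
    from insert.IH[OF N this] have cN: "\<forall>l\<in>N. c l = 0"
      using insert.hyps(2) N nz by (auto simp: field_simps subset_iff)
    then have "scale (c m) (X m) = 0" using R by simp
    then show ?case using X0[OF m] cN by simp
  qed
  have indep: "inj_on X M" "independent (X ` M)"
    using independent_image_if_indexed[of M X] M(1) indexed by auto
  define I where "I = insert a (insert x (X ` M))"
  have "independent I"
    unfolding I_def by (intro independent_insertI indep xT False)
  moreover have "card I = card M + 2"
  proof -
    have "x \<notin> X ` M" using xT by (rule contrapos_nn) (rule span_base)
    moreover have "a \<notin> insert x (X ` M)" using False by (rule contrapos_nn) (rule span_base)
    ultimately show ?thesis unfolding I_def using M(1) by (simp add: card_image[OF indep(1)])
  qed
  ultimately have dimI: "dim I = card M + 2" using dim_eq_card_independent by metis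
  have IS: "I \<subseteq> S" unfolding I_def using a(1) x X(1) by blast
  have sw: "b p q = 0" if "b q p = 0" for p q
    using alt_swap[OF b(1), of p q] that by simp
  have o1: "b x (X l) = 0" if "l \<in> M" for l
    using X(2)[OF that X(1)[OF that]] by (simp add: alt_self[OF b(1)] alt_self[OF w])
  have o2: "b a (X l) = 0" if "l \<in> M" for l
  proof -
    have "l * w (X l) x = 0"
      using X(2)[OF that x] sw[OF o1[OF that]] by (simp add: alt_self[OF b(1)])
    then have "w (X l) x = 0" using M that by auto
    then show ?thesis using a(2)[OF X(1)[OF that]] alt_swap[OF w, of x "X l"] by simp
  qed
  have o3: "b a x = 0" using a(2)[OF x] by (simp add: alt_self[OF w])
  \<comment> \<open>For \<open>l \<noteq> m\<close> the equations of \<open>X l\<close> and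
    \<open>X m\<close> express the same value \<open>b (X l) (X m)\<close> as
    \<open>- l * w (X l) (X m)\<close> and as \<open>- m * w (X l) (X m)\<close>, so both forms
    vanish there.\<close>
  have o4: "b (X l) (X m) = 0" if "l \<in> M" "m \<in> M" for l m
  proof (cases "l = m")
    case True
    then show ?thesis by (simp add: alt_self[OF b(1)])
  next
    case False
    have 1: "b (X l) (X m) + l * w (X l) (X m) = 0"
      using X(2)[OF that(1) X(1)[OF that(2)]] o1[OF that(2)] by simp
    have 2: "b (X l) (X m) + m * w (X l) (X m) = 0"
      using X(2)[OF that(2) X(1)[OF that(1)]] o1[OF that(1)]
      unfolding alt_swap[OF b(1), of "X m" "X l"] alt_swap[OF w, of "X m" "X l"]
      by (metis add.inverse_neutral minus_add_distrib minus_minus mult_minus_right)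
    have "l * w (X l) (X m) = m * w (X l) (X m)" by (metis 1 2 add_left_cancel)
    then show ?thesis using False 1 by auto
  qed
  have o0: "b x x = 0" "b a a = 0" by (simp_all add: alt_self[OF b(1)])
  have "b p q = 0" if "p \<in> I" "q \<in> I" for p q
    using that unfolding I_def
    by (elim insertE imageE) (simp_all add: o0 o1 o2 o3 o4 sw[OF o1] sw[OF o2] sw[OF o3])
  then have "dim I + dim I \<le> dim S" by (intro dim_orthogonal_le[OF S b IS IS])
  then show ?thesis using M(3) dimI by simp
qed

text \<open>On \<open>S\<close> the form \<open>v\<close> is the wedge of \<open>b x\<close> and
  \<open>b z\<close>. Adding multiples of \<open>v\<close> to \<open>b + l w\<close> must never
  create a radical vector, and this forces every resolvent vector to be orthogonal to
  \<open>z\<close>; \<open>resolvent_orthogonal\<close> then transfers the orthogonality to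
  \<open>a\<close>.\<close>

lemma rank_two_orthogonal:
  fixes M :: "'a set"
  assumes S: "subspace S" and K: "forms.subspace K" "K \<subseteq> alt_forms scale"
    and b: "b \<in> alt_forms scale" and nondeg: "\<And>w. w \<in> K \<Longrightarrow> nondegenerate_on S (b + w)"
    and M: "finite M" "0 \<notin> M" "dim S < 2 * (card M + 2)"
    and x: "x \<in> S" and z: "z \<in> S"
    and v: "v \<in> K" "\<And>p q. p \<in> S \<Longrightarrow> q \<in> S \<Longrightarrow> v p q = b x p * b z q - b x q * b z p"
    and w: "w \<in> K" and a: "a \<in> S" "\<And>q. q \<in> S \<Longrightarrow> b a q = w x q"
  shows "b a z = 0"
proof -
  have walt: "w \<in> alt_forms scale" using K w by blast
  have bnd: "nondegenerate_on S b" using nondeg[OF forms.subspace_0[OF K(1)]] by simp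
  have lw: "form_scale l w \<in> K" for l using K(1) w by (rule forms.subspace_scale)
  have balt: "b + form_scale l w \<in> alt_forms scale" for l using K(2) lw b by (blast intro: alt_forms_add)
  have "\<exists>p\<in>S. \<forall>q\<in>S. (b + form_scale l w) p q = b x q" for l
    by (rule functional_representation[OF S balt nondeg[OF lw] b])
  then obtain X where X: "\<And>l. X l \<in> S" "\<And>l q. q \<in> S \<Longrightarrow> b (X l) q + l * w (X l) q = b x q"
    unfolding form_scale_apply plus_fun_apply by metis
  have Xz: "b z p = 0" if p: "p \<in> S" "\<And>q. q \<in> S \<Longrightarrow> b p q + l * w p q = b x q" for p l
  proof (rule ccontr)
    assume c: "b z p \<noteq> 0"
    have xp: "b x p = 0" using p(2)[OF p(1)] by (simp add: alt_self[OF b] alt_self[OF walt])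
    \<comment> \<open>Since \<open>b x p = 0\<close>, the coefficient \<open>1 / b z p\<close> makes
      the multiple of \<open>v\<close> contribute \<open>- b x q\<close> at \<open>p\<close>, which
      cancels \<open>(b + l w) p q = b x q\<close>.\<close>
    let ?u = "form_scale l w + form_scale (1 / b z p) v"
    have "(b + ?u) p q = 0" if q: "q \<in> S" for q
    proof -
      have "(b + ?u) p q = b x q + 1 / b z p * (b x p * b z q - b x q * b z p)"
        by (simp add: form_scale_apply v(2)[OF p(1) q] p(2)[OF q, symmetric] add.assoc)
      then show ?thesis using c xp by simp
    qed
    moreover have "?u \<in> K" by (intro forms.subspace_add[OF K(1)] forms.subspace_scale[OF K(1)] w v(1))
    ultimately have "p = 0" using nondeg p(1) unfolding nondegenerate_on_def by blast
    then show False using c by (simp add: alt_zero_right[OF b])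
  qed
  have sw: "b p z = 0" if "b z p = 0" for p
    using alt_swap[OF b, of p z] that by simp
  show ?thesis
  proof (rule resolvent_orthogonal[OF S b bnd walt M x a(1)])
    show "b a q = w x q" if "q \<in> S" for q using that by (rule a(2))
    show "X l \<in> S" for l by (rule X(1))
    show "b (X l) q + l * w (X l) q = b x q" if "q \<in> S" for l q using that by (rule X(2))
    \<comment> \<open>At \<open>l = 0\<close> the resolvent vector is \<open>x\<close> itself; this
      is why \<open>M\<close> consists of nonzero scalars.\<close>
    show "b x z = 0" using Xz[of x 0] x sw by simp
    show "b (X l) z = 0" for l using Xz[of "X l" l] X sw by simp
  qed
qed

section \<open>Linear maps from spaces of forms to vectors\<close>

lemma subspace_image_on:
  assumes K: "forms.subspace K"
    and add: "\<And>w w'. w \<in> K \<Longrightarrow> w' \<in> K \<Longrightarrow> f (w + w') = f w + f w'"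
    and scale: "\<And>c w. w \<in> K \<Longrightarrow> f (form_scale c w) = scale c (f w)"
  shows "subspace (f ` K)"
proof (rule subspaceI, goal_cases)
  case 1
  have "f 0 = 0" using scale[OF forms.subspace_0[OF K], of 0] by simp
  then show ?case using forms.subspace_0[OF K] by (metis imageI)
next
  case (2 x y)
  then obtain w w' where "w \<in> K" "w' \<in> K" "x = f w" "y = f w'" by blast
  then have "x + y = f (w + w')" "w + w' \<in> K" using add forms.subspace_add[OF K] by auto
  then show ?case by simp
next
  case (3 c x)
  then obtain w where "w \<in> K" "x = f w" by blast
  then have "c *s x = f (form_scale c w)" "form_scale c w \<in> K"
    using scale forms.subspace_scale[OF K] by auto
  then show ?case by simp
qed

lemma subspace_kernel_on:
  assumes K: "forms.subspace K"
    and add: "\<And>w w'. w \<in> K \<Longrightarrow> w' \<in> K \<Longrightarrow> f (w + w') = f w + f w'"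
    and scale: "\<And>c w. w \<in> K \<Longrightarrow> f (form_scale c w) = scale c (f w)"
  shows "forms.subspace {w \<in> K. f w = 0}"
proof (rule forms.subspaceI, goal_cases)
  case 1
  have "f 0 = 0" using scale[OF forms.subspace_0[OF K], of 0] by simp
  then show ?case using forms.subspace_0[OF K] by simp
next
  case (2 x y)
  then show ?case using add forms.subspace_add[OF K] by simp
next
  case (3 c x)
  then show ?case using scale forms.subspace_scale[OF K] by simp
qed

lemma subspace_vanishing:
  assumes "forms.subspace K"
  shows "forms.subspace {w \<in> K. \<forall>p\<in>S. \<forall>q\<in>T. w p q = 0}"
  by (rule forms.subspaceI)
    (use assms in \<open>auto simp: form_scale_apply forms.subspace_0 forms.subspace_add
      forms.subspace_scale\<close>)

text \<open>A representing vector in \<open>S\<close> is unique by nondegeneracy, so any choice of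
  representatives is automatically linear on \<open>K\<close>.\<close>

lemma representative_map:
  assumes S: "subspace S" and b: "b \<in> alt_forms scale" "nondegenerate_on S b"
    and K: "forms.subspace K" "K \<subseteq> alt_forms scale"
  obtains f where "\<And>w. w \<in> K \<Longrightarrow> f w \<in> S"
    and "\<And>w q. w \<in> K \<Longrightarrow> q \<in> S \<Longrightarrow> b (f w) q = w p q"
    and "\<And>w w'. w \<in> K \<Longrightarrow> w' \<in> K \<Longrightarrow> f (w + w') = f w + f w'"
    and "\<And>c w. w \<in> K \<Longrightarrow> f (form_scale c w) = scale c (f w)"
proof -
  have "\<exists>z\<in>S. \<forall>q\<in>S. b z q = w p q" if "w \<in> K" for w
    by (rule functional_representation[OF S b]) (use K(2) that in blast)
  then obtain f where "\<forall>w\<in>K. f w \<in> S \<and> (\<forall>q\<in>S. b (f w) q = w p q)"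
    unfolding Bex_def using bchoice[of K "\<lambda>w z. z \<in> S \<and> (\<forall>q\<in>S. b z q = w p q)"] by blast
  then have f: "\<And>w. w \<in> K \<Longrightarrow> f w \<in> S"
    "\<And>w q. w \<in> K \<Longrightarrow> q \<in> S \<Longrightarrow> b (f w) q = w p q"
    by simp_all
  have f_add: "f (w + w') = f w + f w'" if w: "w \<in> K" "w' \<in> K" for w w'
  proof (rule nondegenerate_on_eqI[OF S b(2,1)])
    have ww: "w + w' \<in> K" using K(1) w by (rule forms.subspace_add)
    show "f (w + w') \<in> S" using ww by (rule f(1))
    show "f w + f w' \<in> S" using S f(1) w by (simp add: subspace_add)
    show "b (f (w + w')) q = b (f w + f w') q" if "q \<in> S" for q
      by (simp add: f(2)[OF ww that] f(2)[OF w(1) that] f(2)[OF w(2) that] alt_add_left[OF b(1)])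
  qed
  have f_scale: "f (form_scale c w) = scale c (f w)" if w: "w \<in> K" for c w
  proof (rule nondegenerate_on_eqI[OF S b(2,1)])
    have cw: "form_scale c w \<in> K" using K(1) w by (rule forms.subspace_scale)
    show "f (form_scale c w) \<in> S" using cw by (rule f(1))
    show "scale c (f w) \<in> S" using S f(1)[OF w] by (rule subspace_scale)
    show "b (f (form_scale c w)) q = b (scale c (f w)) q" if "q \<in> S" for q
      by (simp add: f(2)[OF cw that] f(2)[OF w that] alt_scale_left[OF b(1)] form_scale_apply)
  qed
  show ?thesis by (rule that[OF f f_add f_scale])
qed

lemma span_trans_Un:
  assumes "K \<subseteq> forms.span (C \<union> L)" "L \<subseteq> forms.span (D \<union> N)"
  shows "K \<subseteq> forms.span (C \<union> D \<union> N)"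
proof -
  have "C \<union> L \<subseteq> forms.span (C \<union> D \<union> N)"
    using assms(2) forms.span_mono[of "D \<union> N" "C \<union> D \<union> N"] forms.span_superset[of "C \<union> D \<union> N"]
    by blast
  then show ?thesis
    using assms(1) forms.span_minimal[OF _ forms.subspace_span] by blast
qed

section \<open>Upper bound when all forms are nondegenerate\<close>

text \<open>The forms live on the whole carrier while the induction shrinks \<open>S\<close>, so
  \<open>K\<close> is measured modulo its forms that vanish on \<open>S\<close>. Evenness of
  \<open>n\<close> comes along because every step splits off the plane spanned by \<open>x\<close>
  and \<open>y\<close>.\<close>

lemma nondegenerate_bound:
  assumes "subspace S" "dim S = n" "forms.subspace K" "K \<subseteq> alt_forms scale"
    and "b \<in> alt_forms scale" "\<And>w. w \<in> K \<Longrightarrow> nondegenerate_on S (b + w)"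
    and "infinite (UNIV :: 'a set) \<or> n div 2 \<le> card (UNIV :: 'a set)"
  shows "even n \<and> (\<exists>C. finite C \<and> card C \<le> n div 2 * (n div 2 - 1) \<and>
    K \<subseteq> forms.span (C \<union> {w \<in> K. \<forall>p\<in>S. \<forall>q\<in>S. w p q = 0}))"
  using assms
proof (induction n arbitrary: S K rule: less_induct)
  case (less n)
  note S = less.prems(1) and K = less.prems(3,4) and b = less.prems(5)
  have bnd: "nondegenerate_on S b"
    using less.prems(6)[OF forms.subspace_0[OF K(1)]] by simp
  note eqI = nondegenerate_on_eqI[OF S bnd b]
  show ?case
  proof (cases "n = 0")
    case True
    then have "S \<subseteq> {0}" using less.prems(2) dim_eq_0[of S] by simp
    then have "w p q = 0" if "w \<in> K" "p \<in> S" "q \<in> S" for w p q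
      using that alt_zero_left[of w q] K(2) by blast
    then have "K \<subseteq> forms.span ({} \<union> {w \<in> K. \<forall>p\<in>S. \<forall>q\<in>S. w p q = 0})"
      by (auto intro: forms.span_base)
    then show ?thesis using True by (intro conjI exI[of _ "{}"]) auto
  next
    case False
    then obtain x where x: "x \<in> S" "x \<noteq> 0"
      using less.prems(2) dim_eq_0[of S] by auto
    then obtain y' where y': "y' \<in> S" "b x y' \<noteq> 0" using bnd unfolding nondegenerate_on_def by blast
    define y where "y = scale (1 / b x y') y'"
    have y: "y \<in> S" "b x y = 1"
      using y' S by (simp_all add: y_def subspace_scale alt_simps[OF b])
    then have yx: "b y x = - 1" using alt_swap[OF b, of y x] by simp
    define T where "T = {p \<in> S. b x p = 0 \<and> b y p = 0}"
    have T: "subspace T"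
      unfolding T_def using S by (intro subspaceI) (auto simp: alt_simps[OF b] subspace_0 subspace_add subspace_scale)
    have TS: "T \<subseteq> S" unfolding T_def by blast
    \<comment> \<open>The coefficients are read off by pairing with \<open>x\<close> and
      \<open>y\<close>, since \<open>b x y = 1\<close> and \<open>b y x = - 1\<close>.\<close>
    have decomp: "\<exists>t\<in>T. p = t + scale (b x p) y + scale (- b y p) x" if p: "p \<in> S" for p
    proof (rule bexI)
      show "p - scale (b x p) y - scale (- b y p) x \<in> T"
        unfolding T_def using p y(1) x(1) S
        by (auto simp: alt_simps[OF b] y(2) yx intro!: subspace_diff subspace_scale subspace_add)
    qed simp
    have spT: "span T = T" using T by (metis span_eq_iff)
    have "S = span (insert x (insert y T))"
    proof
      show "S \<subseteq> span (insert x (insert y T))"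
      proof
        fix p assume "p \<in> S"
        from decomp[OF this] obtain t where t: "t \<in> T" "p = t + scale (b x p) y + scale (- b y p) x"
          by blast
        show "p \<in> span (insert x (insert y T))"
          by (subst t(2), intro span_add span_scale span_base) (use t(1) in simp_all)
      qed
      show "span (insert x (insert y T)) \<subseteq> S"
        using x(1) y(1) TS S by (intro span_minimal) auto
    qed
    moreover have "y \<notin> span T" using y by (simp add: spT) (simp add: T_def)
    moreover have "x \<notin> span (insert y T)"
    proof
      assume "x \<in> span (insert y T)"
      then obtain k where "x - scale k y \<in> T" unfolding span_breakdown_eq spT by blast
      then have "b x (x - scale k y) = 0" "b y (x - scale k y) = 0" unfolding T_def by auto
      then show False using y yx by (simp add: alt_simps[OF b])
    qed
    ultimately have n: "n = dim T + 2"
      using less.prems(2) by (simp add: dim_insert)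

    have field_card: "infinite (UNIV :: 'a set) \<or> dim T div 2 \<le> card (UNIV :: 'a set)"
      using less.prems(7) n by auto
    \<comment> \<open>Together with the scalar \<open>0\<close>, which belongs to \<open>x\<close>,
      these make \<open>n div 2\<close> elements of the field.\<close>
    obtain M :: "'a set" where M: "finite M" "0 \<notin> M" "card M = n div 2 - 1"
    proof (cases "finite (UNIV :: 'a set)")
      case True
      then have "n div 2 - 1 \<le> card (UNIV - {0 :: 'a})" using less.prems(7) by simp
      then show ?thesis using obtain_subset_with_card_n that by (metis Diff_iff insertI1 subsetD)
    next
      case False
      then have "infinite (UNIV - {0 :: 'a})" by simp
      then show ?thesis using infinite_arbitrarily_large that by (metis Diff_iff insertI1 subsetD)
    qed
    have Mn: "dim S < 2 * (card M + 2)" using M(3) less.prems(2) n by presburger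

    \<comment> \<open>The image of \<open>K\<close> under \<open>f\<close> is the space
      \<open>A\<close>; the kernel \<open>K1\<close> consists of the forms with
      \<open>w x q = 0\<close> for all \<open>q\<close> in \<open>S\<close>.\<close>
    obtain f where f: "\<And>w. w \<in> K \<Longrightarrow> f w \<in> S" "\<And>w q. w \<in> K \<Longrightarrow> q \<in> S \<Longrightarrow> b (f w) q = w x q"
      and f_lin: "\<And>w w'. w \<in> K \<Longrightarrow> w' \<in> K \<Longrightarrow> f (w + w') = f w + f w'"
        "\<And>c w. w \<in> K \<Longrightarrow> f (form_scale c w) = scale c (f w)"
      using representative_map[OF S b bnd K] by metis
    define K1 where "K1 = {w \<in> K. f w = 0}"
    have K1: "forms.subspace K1" "K1 \<subseteq> alt_forms scale" "K1 \<subseteq> K"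
      using subspace_kernel_on[of K f, OF K(1) f_lin] K(2) unfolding K1_def by auto
    have K1x: "w x q = 0" if "w \<in> K1" "q \<in> S" for w q
      using f(2)[of w q] that alt_zero_left[OF b] unfolding K1_def by auto
    have nondeg1: "nondegenerate_on T (b + w)" if w: "w \<in> K1" for w
      unfolding nondegenerate_on_def
    proof (intro ballI impI)
      fix p assume p: "p \<in> T" "\<forall>q\<in>T. (b + w) p q = 0"
      have walt: "w \<in> alt_forms scale" using w K1 by blast
      let ?c = "b + w"
      have c: "?c \<in> alt_forms scale" using b walt by (rule alt_forms_add)
      have cx: "?c x q = b x q" if "q \<in> S" for q using K1x[OF w that] by simp
      \<comment> \<open>A radical vector \<open>p\<close> of \<open>b + w\<close> on
        \<open>T\<close> is shifted along \<open>x\<close> until it is also orthogonal to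
        \<open>y\<close>. It is then a radical vector on all of \<open>S\<close>, hence
        zero.\<close>
      define k where "k = - ?c p y"
      let ?p = "p + scale k x"
      have pS: "?p \<in> S" using p x TS S by (auto intro!: subspace_add subspace_scale)
      have bxT: "b x t = 0" if "t \<in> T" for t using that by (simp add: T_def)
      have "?c ?p q = 0" if q: "q \<in> S" for q
      proof -
        obtain t where t: "t \<in> T" "q = t + scale (b x q) y + scale (- b y q) x"
          using decomp[OF q] by blast
        have "?c ?p t = 0"
          using p(2) t(1) cx[of t] bxT[of t] TS by (simp only: alt_simps[OF c]) auto
        moreover have "?c ?p y = 0"
          using cx[OF y(1)] y(2) unfolding k_def by (simp only: alt_simps[OF c]) simp
        moreover have "?c ?p x = 0"
        proof -
          have "?c p x = 0"
            using alt_swap[OF c, of p x] cx[of p] bxT[OF p(1)] p(1) TS by auto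
          then show ?thesis by (simp only: alt_simps[OF c]) simp
        qed
        ultimately show ?thesis
          by (subst t(2)) (simp only: alt_add_right[OF c] alt_scale_right[OF c], simp)
      qed
      then have "?p = 0"
        using less.prems(6)[of w] w K1(3) pS unfolding nondegenerate_on_def by blast
      moreover have "b y ?p = - k" using p(1) yx by (simp add: T_def alt_simps[OF b])
      ultimately have "k = 0" by (simp add: alt_zero_right[OF b])
      then show "p = 0" using \<open>?p = 0\<close> by simp
    qed
    define K2 where "K2 = {w \<in> K1. \<forall>p\<in>T. \<forall>q\<in>T. w p q = 0}"
    have "even (dim T) \<and> (\<exists>C. finite C \<and> card C \<le> dim T div 2 * (dim T div 2 - 1) \<and>
      K1 \<subseteq> forms.span (C \<union> K2))"
      unfolding K2_def
      by (rule less.IH[OF _ T refl K1(1,2) b nondeg1 field_card]) (use n in auto)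
    then obtain C2 where evenT: "even (dim T)" and C2: "finite C2"
      "card C2 \<le> dim T div 2 * (dim T div 2 - 1)" "K1 \<subseteq> forms.span (C2 \<union> K2)" by blast
    have K2: "forms.subspace K2" "K2 \<subseteq> alt_forms scale" "K2 \<subseteq> K1"
      using subspace_vanishing[OF K1(1)] K1(2) unfolding K2_def by auto
    \<comment> \<open>The values of \<open>h\<close> represent \<open>B\<close> modulo
      \<open>x\<close>: the normalisation \<open>b (h w) y = w y y = 0\<close> selects one vector in
      a class and excludes \<open>x\<close>.\<close>
    obtain h where h: "\<And>w. w \<in> K2 \<Longrightarrow> h w \<in> S" "\<And>w q. w \<in> K2 \<Longrightarrow> q \<in> S \<Longrightarrow> b (h w) q = w y q"
      and h_lin: "\<And>w w'. w \<in> K2 \<Longrightarrow> w' \<in> K2 \<Longrightarrow> h (w + w') = h w + h w'"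
        "\<And>c w. w \<in> K2 \<Longrightarrow> h (form_scale c w) = scale c (h w)"
      using representative_map[OF S b bnd K2(1,2)] by metis
    \<comment> \<open>A form of \<open>K2\<close> vanishes within \<open>T\<close> and against
      \<open>x\<close>, so after expanding \<open>p\<close> and \<open>q\<close> by
      \<open>decomp\<close> only values \<open>w y _\<close> remain.\<close>
    have wedge: "w p q = b x p * b (h w) q - b x q * b (h w) p"
      if w: "w \<in> K2" and p: "p \<in> S" and q: "q \<in> S" for w p q
    proof -
      have walt: "w \<in> alt_forms scale" using w K2 by blast
      have wx: "w x s = 0" "w s x = 0" if "s \<in> S" for s
        using K1x[of w s] w K2(3) that alt_swap[OF walt, of x s] by auto
      have wT: "w t t' = 0" if "t \<in> T" "t' \<in> T" for t t' using w that unfolding K2_def by blast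
      obtain t where t: "t \<in> T" "p = t + scale (b x p) y + scale (- b y p) x"
        using decomp[OF p] by blast
      obtain t' where t': "t' \<in> T" "q = t' + scale (b x q) y + scale (- b y q) x"
        using decomp[OF q] by blast
      have yq: "w y q = w y t'"
        by (subst t'(2)) (simp add: alt_simps[OF walt] wx[OF y(1)])
      have yp: "w y p = w y t"
        by (subst t(2)) (simp add: alt_simps[OF walt] wx[OF y(1)])
      have tq: "w t q = - b x q * w y p"
        using wx(2)[of t] t(1) TS wT[OF t(1) t'(1)] yp alt_swap[OF walt, of y t]
        by (subst t'(2)) (auto simp add: alt_simps[OF walt])
      have "w p q = w t q + b x p * w y q"
        by (subst t(2)) (simp add: alt_simps[OF walt] wx[OF q])
      then show ?thesis using tq h(2)[OF w p] h(2)[OF w q] by simp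
    qed
    have h0: "{w \<in> K2. h w = 0} \<subseteq> {w \<in> K. \<forall>p\<in>S. \<forall>q\<in>S. w p q = 0}"
    proof clarify
      fix w assume w: "w \<in> K2" "h w = 0"
      then have "w p q = 0" if "p \<in> S" "q \<in> S" for p q
        using wedge[OF w(1) that] by (simp add: alt_zero_left[OF b])
      then show "w \<in> K \<and> (\<forall>p\<in>S. \<forall>q\<in>S. w p q = 0)" using w(1) K2(3) K1(3) by blast
    qed
    obtain C1 where C1: "finite C1" "card C1 \<le> dim (f ` K)" "K \<subseteq> forms.span (C1 \<union> K1)"
      unfolding K1_def by (rule subspace_subset_span_lift[of K f, OF K(1) f_lin])
    obtain C3 where C3: "finite C3" "card C3 \<le> dim (h ` K2)"
      "K2 \<subseteq> forms.span (C3 \<union> {w \<in> K2. h w = 0})"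
      by (rule subspace_subset_span_lift[of K2 h, OF K2(1) h_lin])
    have sw: "b p q = 0" if "b q p = 0" for p q
      using alt_swap[OF b, of q p] that by simp
    \<comment> \<open>If \<open>x = f w\<close>, then \<open>x\<close> is a radical vector of
      \<open>b - w\<close>.\<close>
    have "x \<notin> f ` K"
    proof
      assume "x \<in> f ` K"
      then obtain w where w: "w \<in> K" "x = f w" by blast
      have "form_scale (-1) w \<in> K" using K(1) w(1) by (rule forms.subspace_scale)
      moreover have "\<forall>q\<in>S. (b + form_scale (-1) w) x q = 0"
        using f(2)[OF w(1)] w(2) by (simp add: form_scale_apply)
      ultimately show False using less.prems(6) x unfolding nondegenerate_on_def by blast
    qed
    then have dimA: "dim (insert x (f ` K)) = dim (f ` K) + 1"
      by (simp add: dim_insert iffD2[OF span_eq_iff subspace_image_on[of K f, OF K(1) f_lin]])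
    have "x \<notin> h ` K2"
    proof
      assume "x \<in> h ` K2"
      then obtain w where w: "w \<in> K2" "x = h w" by blast
      then have "b x y = w y y" using h(2)[OF w(1) y(1)] by simp
      also have "\<dots> = 0" using w(1) K2(2) by (blast intro: alt_self)
      finally have "b x y = 0" .
      then show False using y by simp
    qed
    then have dimB: "dim (insert x (h ` K2)) = dim (h ` K2) + 1"
      by (simp add: dim_insert iffD2[OF span_eq_iff subspace_image_on[of K2 h, OF K2(1) h_lin]])
    have fh: "b (f w) (h v) = 0" if w: "w \<in> K" and v: "v \<in> K2" for w v
      by (rule rank_two_orthogonal[OF S K b less.prems(6) M(1,2) Mn x(1) h(1)[OF v] _ wedge[OF v] w
            f(1)[OF w] f(2)[OF w]])
        (use v K2 K1 in auto)
    have fx: "b (f w) x = 0" if "w \<in> K" for w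
      unfolding f(2)[OF that x(1)] using that K(2) by (blast intro: alt_self)
    have xh: "b x (h v) = 0" if v: "v \<in> K2" for v
    proof -
      have "v x y = 0" using K1x[of v y] y v K2(3) by blast
      then have "v y x = 0" using alt_swap[of v x y] K2(2) v by auto
      then show ?thesis using h(2)[OF v x(1)] sw by simp
    qed
    \<comment> \<open>Adjoining \<open>x\<close>, which is orthogonal to both spaces and lies in
      neither, improves the bound on the sum of their dimensions from \<open>dim S\<close> to
      \<open>dim S - 2 = dim T\<close>.\<close>
    have "dim (insert x (f ` K)) + dim (insert x (h ` K2)) \<le> dim S"
      by (rule dim_orthogonal_le[OF S b bnd]) (use x f h fh fx xh alt_self[OF b] in auto)
    then have dims: "dim (f ` K) + dim (h ` K2) \<le> dim T"
      using dimA dimB n less.prems(2) by linarith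
    define m where "m = dim T div 2"
    have m: "dim T = 2 * m" "n div 2 = Suc m" using evenT n unfolding m_def by auto
    let ?C = "C1 \<union> C2 \<union> C3"
    have "K \<subseteq> forms.span (C1 \<union> C2 \<union> K2)" using C1(3) C2(3) by (rule span_trans_Un)
    from span_trans_Un[OF this C3(3)]
    have "K \<subseteq> forms.span (?C \<union> {w \<in> K2. h w = 0})" .
    also have "\<dots> \<subseteq> forms.span (?C \<union> {w \<in> K. \<forall>p\<in>S. \<forall>q\<in>S. w p q = 0})"
      using h0 by (intro forms.span_mono) blast
    finally have "K \<subseteq> forms.span (?C \<union> {w \<in> K. \<forall>p\<in>S. \<forall>q\<in>S. w p q = 0})" .
    moreover have "card ?C \<le> n div 2 * (n div 2 - 1)"
    proof -
      have "card ?C \<le> card C1 + card C2 + card C3"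
        by (meson add_le_mono1 card_Un_le order.trans)
      also have "\<dots> \<le> 2 * m + m * (m - 1)"
        using C1(2) C2(2) C3(2) dims unfolding m_def[symmetric] m(1)[unfolded m_def, symmetric]
        using m(1) by linarith
      also have "\<dots> = n div 2 * (n div 2 - 1)"
        unfolding m(2) by (cases m) auto
      finally show ?thesis .
    qed
    ultimately show ?thesis
      using C1(1) C2(1) C3(1) evenT n by (intro conjI exI[of _ ?C]) auto
  qed
qed

end

section \<open>Counting identities\<close>

lemma sum_odd_numbers: "(\<Sum>k<s. 2 * k + 1) = (s::nat)\<^sup>2"
  by (induction s) (auto simp: power2_eq_square)

lemma card_triangle: "card (Sigma {..<n} lessThan) = n * (n - 1) div 2"
proof -
  have "(\<Sum>j<n. j) = n * (n - 1) div 2"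
    using Sum_Ico_nat[of 0 n] by (simp add: atLeast0LessThan)
  then show ?thesis by simp
qed

text \<open>Index \<open>j = s + k\<close> contributes \<open>2 * k + 1\<close> positions, and the
  odd numbers sum to a square. These are the positions \<open>i < j\<close> on or below the
  antidiagonal of the leading block, where the extremal space has its conditions.\<close>

lemma card_antitriangle: "card (SIGMA j:{s..<2 * s}. {2 * s - 1 - j..<j}) = s\<^sup>2"
proof -
  have "(\<Sum>j=s..<2 * s. j - (2 * s - 1 - j)) = (\<Sum>j=0 + s..<s + s. j - (2 * s - 1 - j))"
    by (simp add: mult_2)
  also have "\<dots> = (\<Sum>k=0..<s. (k + s) - (2 * s - 1 - (k + s)))"
    by (rule sum.shift_bounds_nat_ivl)
  also have "\<dots> = (\<Sum>k<s. 2 * k + 1)"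
    by (rule sum.cong) auto
  also have "\<dots> = s\<^sup>2" by (rule sum_odd_numbers)
  finally show ?thesis by (subst card_SigmaI) simp_all
qed

text \<open>Writing \<open>n = 2 * s + m\<close> removes the truncated subtractions, and naming the
  half \<open>q\<close> of \<open>m * (m - 1)\<close> removes the division.\<close>

lemma nat_triangle_minus_square:
  fixes n s :: nat
  assumes "2 * s \<le> n"
  shows "s * (s - 1) + 2 * s * (n - 2 * s) + (n - 2 * s) * (n - 2 * s - 1) div 2
    = n * (n - 1) div 2 - s\<^sup>2"
proof -
  define m where "m = n - 2 * s"
  have n: "n = 2 * s + m" using assms by (simp add: m_def)
  have "even (m * (m - 1))" by (cases m) auto
  then obtain q where q: "m * (m - 1) = 2 * q" by (rule evenE)
  have mm: "m * m = 2 * q + m" using q by (cases m) auto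
  have "n * (n - 1) = 2 * (s * (s - 1) + 2 * s * m + q + s\<^sup>2)"
    using mm unfolding n by (cases s; cases m) (auto simp: power2_eq_square algebra_simps)
  then have "n * (n - 1) div 2 = s * (s - 1) + 2 * s * m + q + s\<^sup>2" by simp
  then show ?thesis using q by (simp add: m_def[symmetric])
qed

section \<open>Upper bound for forms of rank at least \<open>2 * s\<close>\<close>

context finite_dimensional_vector_space
begin

text \<open>In the nondegenerate case the dimension is \<open>2 * m\<close> with
  \<open>s \<le> m\<close>, and \<open>m * (m - 1) + m * m\<close> is exactly the number of pairs.
  In the degenerate case one radical vector is split off and the base point moves to the degenerate
  form \<open>b + u\<close>, at the cost of as many dimensions as the complement has.\<close>

lemma rank_bound:
  assumes "subspace S" "dim S = n" "forms.subspace K" "K \<subseteq> alt_forms scale" "b \<in> alt_forms scale"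
    and "\<And>w. w \<in> K \<Longrightarrow> dim {x \<in> S. \<forall>y\<in>S. (b + w) x y = 0} + 2 * s \<le> n"
    and "infinite (UNIV :: 'a set) \<or> n div 2 \<le> card (UNIV :: 'a set)"
  shows "\<exists>C. finite C \<and> card C + s\<^sup>2 \<le> n * (n - 1) div 2 \<and>
    K \<subseteq> forms.span (C \<union> {w \<in> K. \<forall>p\<in>S. \<forall>q\<in>S. w p q = 0})"
  using assms
proof (induction n arbitrary: S K b)
  case 0
  then have "S \<subseteq> {0}" using dim_eq_0[of S] by simp
  then have "w p q = 0" if "w \<in> K" "p \<in> S" "q \<in> S" for w p q
    using that alt_zero_left[of w q] 0(4) by blast
  then have "K \<subseteq> forms.span ({} \<union> {w \<in> K. \<forall>p\<in>S. \<forall>q\<in>S. w p q = 0})"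
    by (auto intro: forms.span_base)
  moreover have "s = 0" using 0(6)[OF forms.subspace_0[OF 0(3)]] by simp
  ultimately show ?case by (intro exI[of _ "{}"]) simp
next
  case (Suc n)
  note S = Suc.prems(1) and K = Suc.prems(3,4) and b = Suc.prems(5)
  show ?case
  proof (cases "\<forall>w\<in>K. nondegenerate_on S (b + w)")
    case True
    obtain C where C: "even (Suc n)" "finite C" "card C \<le> Suc n div 2 * (Suc n div 2 - 1)"
      "K \<subseteq> forms.span (C \<union> {w \<in> K. \<forall>p\<in>S. \<forall>q\<in>S. w p q = 0})"
      using nondegenerate_bound[OF S Suc.prems(2) K b _ Suc.prems(7)] True by blast
    define m where "m = Suc n div 2"
    have m: "Suc n = 2 * m" using C(1) by (simp add: m_def)
    have "s \<le> m" using Suc.prems(6)[OF forms.subspace_0[OF K(1)]] m by simp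
    then have "s\<^sup>2 \<le> m\<^sup>2" by (rule power_mono) simp
    moreover have "Suc n * (Suc n - 1) div 2 = m * (m - 1) + m\<^sup>2"
      unfolding m by (cases m) (auto simp: power2_eq_square)
    ultimately have "card C + s\<^sup>2 \<le> Suc n * (Suc n - 1) div 2"
      using C(3) unfolding m_def[symmetric] by linarith
    then show ?thesis using C(2,4) by blast
  next
    case False
    then obtain u x where u: "u \<in> K" and x: "x \<in> S" "x \<noteq> 0" "\<And>q. q \<in> S \<Longrightarrow> (b + u) x q = 0"
      unfolding nondegenerate_on_def by blast
    have "independent {x}" using x(2) by simp
    then obtain E where E: "{x} \<subseteq> E" "E \<subseteq> S" "independent E" "S \<subseteq> span E"
      using maximal_independent_subset_extend[of "{x}" S] x(1) by blast
    have fin: "finite E" using E(3) by (rule finiteI_independent)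
    have SE: "S = span E" using E S by (metis span_subspace)
    define F where "F = E - {x}"
    define T where "T = span F"
    have F: "finite F" "independent F" "insert x F = E"
      using fin E independent_mono[OF E(3)] unfolding F_def by auto
    have T: "subspace T" "T \<subseteq> S"
      unfolding T_def SE F_def by (simp_all add: span_mono)
    have xT: "x \<notin> T"
      using E(1,3) unfolding T_def F_def dependent_def by blast
    have dimT: "dim T = n"
    proof -
      have "card E = Suc n" using Suc.prems(2) dim_span_eq_card_independent[OF E(3)] SE by simp
      then have "card F = n" unfolding F_def using E(1) fin by simp
      then show ?thesis unfolding T_def using dim_span_eq_card_independent[OF F(2)] by simp
    qed
    \<comment> \<open>The vector \<open>f w\<close> records the values \<open>w x e\<close> on
      \<open>F\<close>. As \<open>x\<close> and \<open>F\<close> span \<open>S\<close>, it is zero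
      exactly when \<open>w x\<close> vanishes on \<open>S\<close>.\<close>
    define f where "f = (\<lambda>w :: 'b \<Rightarrow> 'b \<Rightarrow> 'a. \<Sum>e\<in>F. scale (w x e) e)"
    have f_lin: "f (w + w') = f w + f w'" "f (form_scale c w) = scale c (f w)" for w w' c
      by (simp_all add: f_def form_scale_apply scale_left_distrib sum.distrib scale_sum_right)
    define K1 where "K1 = {w \<in> K. f w = 0}"
    have K1: "forms.subspace K1" "K1 \<subseteq> alt_forms scale" "K1 \<subseteq> K"
      using subspace_kernel_on[of K f, OF K(1) f_lin] K(2) unfolding K1_def by auto
    have K1x: "w x q = 0" if w: "w \<in> K1" and q: "q \<in> S" for w q
    proof -
      have walt: "w \<in> alt_forms scale" using w K1 by blast
      have "f w = 0" using w by (simp add: K1_def)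
      then have wF: "w x e = 0" if "e \<in> F" for e
        using independentD[OF F(2,1) order.refl _ that] unfolding f_def by blast
      have "q \<in> span E" using q SE by simp
      then show ?thesis
      proof (induction rule: span_induct)
        case base
        show ?case by (rule subspaceI) (auto simp: alt_simps[OF walt])
      next
        case (step e)
        then show ?case using wF F(3) by (auto simp: alt_self[OF walt])
      qed
    qed
    have bu: "b + u \<in> alt_forms scale" using b u K(2) by (blast intro: alt_forms_add)
    \<comment> \<open>A radical vector on \<open>T\<close> remains one on \<open>S\<close>, because
      \<open>x\<close> is radical for \<open>b + u + w\<close>. Since \<open>x\<close> is a further
      radical vector outside \<open>T\<close>, the nullity drops together with the dimension, and
      \<open>s\<close> is kept.\<close>
    have rad: "dim {p \<in> T. \<forall>q\<in>T. (b + u + w) p q = 0} + 2 * s \<le> n" if w: "w \<in> K1" for w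
    proof -
      let ?c = "b + (u + w)"
      have uw: "u + w \<in> K" using K(1) u w K1(3) by (blast intro: forms.subspace_add)
      have c: "?c \<in> alt_forms scale" using b uw K(2) by (blast intro: alt_forms_add)
      have cx: "?c x q = 0" if "q \<in> S" for q using x(3)[OF that] K1x[OF w that] by (simp add: add.assoc[symmetric])
      define R where "R = {p \<in> T. \<forall>q\<in>T. ?c p q = 0}"
      have "subspace R"
        unfolding R_def using T(1)
        by (intro subspaceI) (auto simp only: mem_Collect_eq alt_simps[OF c] subspace_0 subspace_add
            subspace_scale add_0 mult_zero_right)
      then have spR: "span R = R" by (rule iffD2[OF span_eq_iff])
      have "x \<notin> span R" unfolding spR using xT by (simp add: R_def)
      then have "dim (insert x R) = dim R + 1" by (simp add: dim_insert)
      moreover have "insert x R \<subseteq> {p \<in> S. \<forall>q\<in>S. ?c p q = 0}"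
      proof -
        have "?c p q = 0" if p: "p \<in> R" and q: "q \<in> S" for p q
        proof -
          have cpx: "?c p x = 0"
          proof -
            have "?c x p = 0" using cx p T(2) unfolding R_def by blast
            then show ?thesis by (subst alt_swap[OF c]) simp
          qed
          have "q \<in> span E" using q SE by simp
          then show ?thesis
          proof (induction rule: span_induct)
            case base
            show ?case by (rule subspaceI) (auto simp only: mem_Collect_eq alt_simps[OF c] add_0 mult_zero_right)
          next
            case (step e)
            then consider "e = x" | "e \<in> F" using F(3) by blast
            then show ?case
            proof cases
              case 2
              then have "e \<in> T" unfolding T_def by (rule span_base)
              then show ?thesis using p unfolding R_def by blast
            qed (use cpx in blast)
          qed
        qed
        moreover have "R \<subseteq> S" unfolding R_def using T(2) by blast
        ultimately show ?thesis using cx x(1) by blast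
      qed
      then have "dim (insert x R) \<le> dim {p \<in> S. \<forall>q\<in>S. ?c p q = 0}" by (rule dim_subset)
      ultimately have "dim R + 2 * s \<le> n" using Suc.prems(6)[OF uw] by linarith
      then show ?thesis unfolding R_def add.assoc .
    qed
    have field_card: "infinite (UNIV :: 'a set) \<or> n div 2 \<le> card (UNIV :: 'a set)"
      using Suc.prems(7) by auto
    define K2 where "K2 = {w \<in> K1. \<forall>p\<in>T. \<forall>q\<in>T. w p q = 0}"
    obtain C2 where C2: "finite C2" "card C2 + s\<^sup>2 \<le> n * (n - 1) div 2" "K1 \<subseteq> forms.span (C2 \<union> K2)"
      using Suc.IH[OF T(1) dimT K1(1,2) bu rad field_card] unfolding K2_def by blast
    have K2: "K2 \<subseteq> {w \<in> K. \<forall>p\<in>S. \<forall>q\<in>S. w p q = 0}"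
    proof
      fix w assume w: "w \<in> K2"
      then have wK: "w \<in> K1" and wT: "\<And>p q. p \<in> T \<Longrightarrow> q \<in> T \<Longrightarrow> w p q = 0"
        unfolding K2_def by auto
      have walt: "w \<in> alt_forms scale" using wK K1 by blast
      have spT: "span T = T" using T(1) by (metis span_eq_iff)
      have "w p q = 0" if p: "p \<in> S" and q: "q \<in> S" for p q
      proof -
        have d: "\<exists>k. p - scale k x \<in> T" if "p \<in> S" for p
          using that unfolding SE F(3)[symmetric] span_breakdown_eq T_def .
        obtain k l where kl: "p - scale k x \<in> T" "q - scale l x \<in> T" using d[OF p] d[OF q] by blast
        have "w p x = 0" using K1x[OF wK p] by (subst alt_swap[OF walt]) simp
        then show ?thesis
          using wT[OF kl] K1x[OF wK q] by (simp add: alt_simps[OF walt])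
      qed
      then show "w \<in> {w \<in> K. \<forall>p\<in>S. \<forall>q\<in>S. w p q = 0}" using wK K1(3) by blast
    qed
    obtain C1 where C1: "finite C1" "card C1 \<le> dim (f ` K)" "K \<subseteq> forms.span (C1 \<union> K1)"
      unfolding K1_def by (rule subspace_subset_span_lift[of K f, OF K(1) f_lin])
    have "f ` K \<subseteq> T"
      unfolding f_def T_def by (intro image_subsetI span_sum span_scale span_base)
    then have "dim (f ` K) \<le> n" using dim_subset dimT by metis
    then have card: "card (C1 \<union> C2) + s\<^sup>2 \<le> n + n * (n - 1) div 2"
      using card_Un_le[of C1 C2] C1(2) C2(2) by linarith
    also have "\<dots> = (2 * n + n * (n - 1)) div 2" by simp
    also have "2 * n + n * (n - 1) = Suc n * (Suc n - 1)" by (cases n) auto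
    finally have "card (C1 \<union> C2) + s\<^sup>2 \<le> Suc n * (Suc n - 1) div 2" .
    moreover have "K \<subseteq> forms.span (C1 \<union> C2 \<union> {w \<in> K. \<forall>p\<in>S. \<forall>q\<in>S. w p q = 0})"
      by (rule order.trans[OF span_trans_Un[OF C1(3) C2(3)] forms.span_mono[OF Un_mono[OF order.refl K2]]])
    ultimately show ?thesis using C1(1) C2(1) by (intro exI[of _ "C1 \<union> C2"]) simp
  qed
qed

section \<open>Coordinates and the wedge basis of the alternating forms\<close>

text \<open>Numbering \<open>Basis\<close> by natural numbers turns forms into matrices, so that
  positions relative to an antidiagonal make sense later.\<close>

lemma dual_basis:
  "\<exists>(e :: nat \<Rightarrow> 'b) d. (\<forall>i u v. d i (u + v) = d i u + d i v) \<and> (\<forall>i c v. d i (scale c v) = c * d i v)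
    \<and> (\<forall>i<dim UNIV. \<forall>j<dim UNIV. d i (e j) = of_bool (i = j))
    \<and> (\<forall>v. v = (\<Sum>i<dim UNIV. scale (d i v) (e i)))"
proof -
  obtain e where e: "bij_betw e {0..<card Basis} Basis"
    using ex_bij_betw_nat_finite[OF finite_Basis] by blast
  have n: "dim UNIV = card Basis" by simp
  have B: "independent Basis" "\<And>v. v \<in> span Basis"
    using independent_Basis span_Basis by auto
  define d where "d i v = representation Basis v (e i)" for i v
  have eB: "e i \<in> Basis" if "i < card Basis" for i
    using e that unfolding bij_betw_def by auto
  show ?thesis
  proof (intro exI[of _ e] exI[of _ d] conjI allI impI)
    show "d i (u + v) = d i u + d i v" for i u v
      unfolding d_def by (simp add: representation_add[OF B(1) B(2) B(2)])
    show "d i (scale c v) = c * d i v" for i c v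
      unfolding d_def by (simp add: representation_scale[OF B(1) B(2)])
    show "d i (e j) = of_bool (i = j)" if "i < dim UNIV" "j < dim UNIV" for i j
    proof -
      have "e j = e i \<longleftrightarrow> i = j"
        using that e unfolding n bij_betw_def inj_on_def by auto
      then show ?thesis
        using that unfolding d_def n by (auto simp: representation_basis[OF B(1) eB])
    qed
    show "v = (\<Sum>i<dim UNIV. scale (d i v) (e i))" for v
    proof -
      have "v = (\<Sum>c\<in>Basis. scale (representation Basis v c) c)"
        using sum_representation_eq[OF B(1) B(2) finite_Basis order.refl, of v] by simp
      also have "\<dots> = (\<Sum>i\<in>{0..<card Basis}. scale (d i v) (e i))"
        unfolding d_def by (rule sum.reindex_bij_betw[OF e, symmetric])
      finally show ?thesis unfolding n atLeast0LessThan .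
    qed
  qed
qed

end

text \<open>The larger index comes first, matching \<open>Sigma {..<n} lessThan\<close>. The
  orientation is such that \<open>wedge d (j, i)\<close> takes the value \<open>1\<close> at
  \<open>e i\<close>, \<open>e j\<close> when \<open>d\<close> is dual to \<open>e\<close>.\<close>

definition wedge :: "(nat \<Rightarrow> 'v \<Rightarrow> 'a::comm_ring) \<Rightarrow> nat \<times> nat \<Rightarrow> 'v \<Rightarrow> 'v \<Rightarrow> 'a" where
  "wedge d p = (\<lambda>x y. d (snd p) x * d (fst p) y - d (fst p) x * d (snd p) y)"

lemma wedge_basis:
  fixes d :: "nat \<Rightarrow> 'v \<Rightarrow> 'a::comm_ring_1"
  assumes "\<And>i j. i < n \<Longrightarrow> j < n \<Longrightarrow> d i (e j) = of_bool (i = j)"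
    and "p \<in> Sigma {..<n} lessThan" "k < n" "l < n"
  shows "wedge d p (e k) (e l) = of_bool (p = (l, k)) - of_bool (p = (k, l))"
proof -
  obtain j i where p: "p = (j, i)" by (cases p)
  have ij: "i < n" "j < n" using assms(2) unfolding p by auto
  have "wedge d p (e k) (e l) = of_bool (i = k) * of_bool (j = l) - of_bool (j = k) * of_bool (i = l)"
    unfolding wedge_def p fst_conv snd_conv
    by (simp only: assms(1)[OF ij(1) assms(3)] assms(1)[OF ij(1) assms(4)]
        assms(1)[OF ij(2) assms(3)] assms(1)[OF ij(2) assms(4)])
  also have "\<dots> = of_bool (p = (l, k)) - of_bool (p = (k, l))"
    unfolding p prod.inject of_bool_conj by (simp only: mult.commute)
  finally show ?thesis .
qed

lemma wedge_basis_self: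
  fixes d :: "nat \<Rightarrow> 'v \<Rightarrow> 'a::comm_ring_1"
  assumes dual: "\<And>i j. i < n \<Longrightarrow> j < n \<Longrightarrow> d i (e j) = of_bool (i = j)"
    and p: "p \<in> Sigma {..<n} lessThan" and q: "q \<in> Sigma {..<n} lessThan"
  shows "wedge d q (e (snd p)) (e (fst p)) = of_bool (q = p)"
proof -
  have "snd p < n" "fst p < n" using p by auto
  from wedge_basis[of n d e, OF dual q this]
  have "wedge d q (e (snd p)) (e (fst p)) = of_bool (q = p) - of_bool (q = (snd p, fst p))" by simp
  moreover have "q \<noteq> (snd p, fst p)" using p q by auto
  ultimately show ?thesis by simp
qed

lemma wedge_inj_on:
  fixes d :: "nat \<Rightarrow> 'v \<Rightarrow> 'a::comm_ring_1"
  assumes dual: "\<And>i j. i < n \<Longrightarrow> j < n \<Longrightarrow> d i (e j) = of_bool (i = j)"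
  shows "inj_on (wedge d) (Sigma {..<n} lessThan)"
proof (rule inj_onI)
  fix p q assume pq: "p \<in> Sigma {..<n} lessThan" "q \<in> Sigma {..<n} lessThan" "wedge d p = wedge d q"
  have "(of_bool (q = p) :: 'a) = wedge d q (e (snd p)) (e (fst p))"
    by (rule wedge_basis_self[of n d e, OF dual pq(1,2), symmetric])
  also have "\<dots> = wedge d p (e (snd p)) (e (fst p))" by (simp only: pq(3))
  also have "\<dots> = of_bool (p = p)"
    by (rule wedge_basis_self[of n d e, OF dual pq(1,1)])
  finally have "of_bool (q = p) = (1 :: 'a)" by simp
  then have "q = p" unfolding of_bool_eq_1_iff .
  then show "p = q" by (rule sym)
qed

text \<open>Evaluation at the position of \<open>p\<close> is linear, gives \<open>1\<close> on
  \<open>wedge d p\<close>, and vanishes on the span of the other wedges.\<close>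

lemma wedge_independent:
  fixes d :: "nat \<Rightarrow> 'v \<Rightarrow> 'a::field"
  assumes dual: "\<And>i j. i < n \<Longrightarrow> j < n \<Longrightarrow> d i (e j) = of_bool (i = j)"
  shows "forms.independent (wedge d ` Sigma {..<n} lessThan)"
proof
  let ?P = "Sigma {..<n} lessThan"
  assume "forms.dependent (wedge d ` ?P)"
  then obtain p where p: "p \<in> ?P" "wedge d p \<in> forms.span (wedge d ` ?P - {wedge d p})"
    unfolding forms.dependent_def by blast
  have "w (e (snd p)) (e (fst p)) = 0" if "w \<in> forms.span (wedge d ` ?P - {wedge d p})" for w
    using that
  proof (induction rule: forms.span_induct)
    case base
    show ?case by (rule forms.subspaceI) (auto simp: form_scale_apply)
  next
    case (step w)
    then obtain q where q: "q \<in> ?P" "w = wedge d q" "q \<noteq> p" by blast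
    have "w (e (snd p)) (e (fst p)) = of_bool (q = p)"
      unfolding q(2) by (rule wedge_basis_self[of n d e, OF dual p(1) q(1)])
    then show ?case using q(3) by simp
  qed
  note this[OF p(2)]
  moreover have "wedge d p (e (snd p)) (e (fst p)) = of_bool (p = p)"
    by (rule wedge_basis_self[of n d e, OF dual p(1,1)])
  ultimately show False by simp
qed

lemma sum_form_apply: "(\<Sum>i\<in>A. f i) x y = (\<Sum>i\<in>A. f i x y :: 'a::comm_monoid_add)"
  by (induction A rule: infinite_finite_induct) simp_all

text \<open>With \<open>S\<close> the whole space, the forms that vanish on \<open>S\<close> reduce
  to zero, and the relative bounds become bounds on the dimension.\<close>

lemma span_Un_vanishing:
  "forms.span (C \<union> {w \<in> K. \<forall>p\<in>UNIV. \<forall>q\<in>UNIV. w p q = 0}) \<subseteq> forms.span C"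
proof (rule forms.span_minimal[OF _ forms.subspace_span])
  have "{w \<in> K. \<forall>p\<in>UNIV. \<forall>q\<in>UNIV. w p q = 0} \<subseteq> {0}" by (auto simp: fun_eq_iff)
  also have "{0} \<subseteq> forms.span C" using forms.span_zero by simp
  finally show "C \<union> {w \<in> K. \<forall>p\<in>UNIV. \<forall>q\<in>UNIV. w p q = 0} \<subseteq> forms.span C"
    using forms.span_superset by (rule Un_least[rotated])
qed

context finite_dimensional_vector_space
begin

lemma wedge_in_alt_forms:
  assumes "\<And>i u v. d i (u + v) = d i u + d i v" "\<And>i c v. d i (scale c v) = c * d i v"
  shows "wedge d p \<in> alt_forms scale"
  by (auto simp: alt_forms_def bilinear_form_def wedge_def assms algebra_simps)

text \<open>The wedges supply enough independent forms. Conversely \<open>rank_bound\<close> with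
  \<open>s = 0\<close> and base point \<open>0\<close>, where the rank condition always holds,
  supplies a spanning set of at most the same size, so no form can lie outside the span of the
  wedges.\<close>

lemma dim_alt_forms:
  assumes "dim UNIV = n" "infinite (UNIV :: 'a set) \<or> n div 2 \<le> card (UNIV :: 'a set)"
  shows "forms.dim (alt_forms scale) = n * (n - 1) div 2"
proof -
  from dual_basis[unfolded assms(1)] obtain e :: "nat \<Rightarrow> 'b" and d
    where "(\<forall>i u v. d i (u + v) = d i u + d i v) \<and> (\<forall>i c v. d i (scale c v) = c * d i v)
      \<and> (\<forall>i<n. \<forall>j<n. d i (e j) = of_bool (i = j)) \<and> (\<forall>v. v = (\<Sum>i<n. scale (d i v) (e i)))"
    by (elim exE)
  then have d: "\<And>i u v. d i (u + v) = d i u + d i v" "\<And>i c v. d i (scale c v) = c * d i v"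
    "\<And>i j. i < n \<Longrightarrow> j < n \<Longrightarrow> d i (e j) = of_bool (i = j)"
    "\<And>v. v = (\<Sum>i<n. scale (d i v) (e i))"
    by blast+
  let ?P = "Sigma {..<n} lessThan"
  let ?B = "wedge d ` ?P"
  have B: "forms.independent ?B" by (rule wedge_independent[of n d e, OF d(3)])
  have cardB: "card ?B = n * (n - 1) div 2"
    using card_image[OF wedge_inj_on[of n d e, OF d(3)]] card_triangle by simp
  have Balt: "?B \<subseteq> alt_forms scale" using wedge_in_alt_forms[of d, OF d(1,2)] by blast
  have "\<exists>C. finite C \<and> card C + 0\<^sup>2 \<le> n * (n - 1) div 2 \<and>
    alt_forms scale \<subseteq> forms.span (C \<union> {w \<in> alt_forms scale. \<forall>p\<in>UNIV. \<forall>q\<in>UNIV. w p q = 0})"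
  proof (rule rank_bound[OF subspace_UNIV assms(1) subspace_alt_forms order.refl _ _ assms(2)])
    show "0 \<in> alt_forms scale" by (rule forms.subspace_0[OF subspace_alt_forms])
    show "dim {x \<in> UNIV. \<forall>y\<in>UNIV. (0 + w) x y = 0} + 2 * 0 \<le> n" for w
      by (simp only: mult_zero_right add_0_right assms(1)[symmetric]) (rule dim_subset[OF subset_UNIV])
  qed
  then obtain C where C: "finite C" "card C \<le> n * (n - 1) div 2"
    "alt_forms scale \<subseteq> forms.span (C \<union> {w \<in> alt_forms scale. \<forall>p\<in>UNIV. \<forall>q\<in>UNIV. w p q = 0})"
    by auto
  have span: "alt_forms scale \<subseteq> forms.span C"
    by (rule order.trans[OF C(3) span_Un_vanishing])
  have "alt_forms scale \<subseteq> forms.span ?B"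
  proof (rule subsetI, rule ccontr)
    fix w assume w: "w \<in> alt_forms scale" "w \<notin> forms.span ?B"
    then have "forms.independent (insert w ?B)" using B by (rule_tac forms.independent_insertI)
    moreover have "insert w ?B \<subseteq> forms.span C" using w(1) Balt span by blast
    ultimately have "card (insert w ?B) \<le> card C"
      using forms.independent_span_bound[OF C(1)] by blast
    moreover have "w \<notin> ?B" using w(2) by (rule contrapos_nn) (rule forms.span_base)
    ultimately show False using cardB C(2) by (simp add: card_insert_disjoint)
  qed
  from forms.basis_card_eq_dim[OF Balt this B] show ?thesis using cardB by simp
qed

section \<open>An extremal affine space\<close>

text \<open>In the leading block the forms of \<open>W\<close> vanish on and below the antidiagonal,
  while \<open>b\<close> is nonzero on it and zero below. Substitution along the antidiagonal shows
  that a radical vector is determined by its coordinates from \<open>2 * s\<close> on, which bounds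
  the nullity by \<open>n - 2 * s\<close>.\<close>

lemma rank_construction:
  assumes n: "dim UNIV = n" and s: "2 * s \<le> n"
  shows "\<exists>b W. b \<in> alt_forms scale \<and> W \<subseteq> alt_forms scale \<and> forms.subspace W \<and>
    forms.dim W = n * (n - 1) div 2 - s\<^sup>2 \<and>
    (\<forall>w\<in>W. dim {x. \<forall>y. (b + w) x y = 0} + 2 * s \<le> n)"
proof -
  from dual_basis[unfolded n] obtain e :: "nat \<Rightarrow> 'b" and d
    where "(\<forall>i u v. d i (u + v) = d i u + d i v) \<and> (\<forall>i c v. d i (scale c v) = c * d i v)
      \<and> (\<forall>i<n. \<forall>j<n. d i (e j) = of_bool (i = j)) \<and> (\<forall>v. v = (\<Sum>i<n. scale (d i v) (e i)))"
    by (elim exE)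
  then have d: "\<And>i u v. d i (u + v) = d i u + d i v" "\<And>i c v. d i (scale c v) = c * d i v"
    "\<And>i j. i < n \<Longrightarrow> j < n \<Longrightarrow> d i (e j) = of_bool (i = j)"
    "\<And>v. v = (\<Sum>i<n. scale (d i v) (e i))"
    by blast+
  let ?P = "Sigma {..<n} lessThan"
  define Z where "Z = (SIGMA j:{s..<2 * s}. {2 * s - 1 - j..<j})"
  define W where "W = forms.span (wedge d ` (?P - Z))"
  define b where "b = (\<Sum>i<s. wedge d (2 * s - 1 - i, i))"
  have wedge_alt: "wedge d p \<in> alt_forms scale" for p by (rule wedge_in_alt_forms[OF d(1,2)])
  have b: "b \<in> alt_forms scale"
    unfolding b_def by (intro forms.subspace_sum[OF subspace_alt_forms] wedge_alt)
  have W: "W \<subseteq> alt_forms scale"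
    unfolding W_def by (intro forms.span_minimal[OF _ subspace_alt_forms]) (use wedge_alt in blast)
  have ZP: "Z \<subseteq> ?P" using s by (auto simp: Z_def)
  have finP: "finite ?P" by simp
  have "forms.dim W = card (wedge d ` (?P - Z))"
    unfolding W_def
    by (intro forms.dim_span_eq_card_independent forms.independent_mono[OF wedge_independent[of n d e, OF d(3)]])
      auto
  also have "\<dots> = card (?P - Z)"
    by (intro card_image inj_on_subset[OF wedge_inj_on[of n d e, OF d(3)]]) auto
  also have "\<dots> = n * (n - 1) div 2 - s\<^sup>2"
    using card_Diff_subset[OF finite_subset[OF ZP finP] ZP] card_triangle[of n]
      card_antitriangle[of s] unfolding Z_def by simp
  finally have dimW: "forms.dim W = n * (n - 1) div 2 - s\<^sup>2" .
  have W0: "w (e k) (e l) = 0" if "w \<in> W" and kl: "k < 2 * s" "l < 2 * s" "2 * s - 1 \<le> k + l" for w k l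
    using that(1) unfolding W_def
  proof (induction rule: forms.span_induct)
    case base
    show ?case by (rule forms.subspaceI) (auto simp: form_scale_apply)
  next
    case (step w)
    then obtain p where p: "p \<in> ?P" "p \<notin> Z" "w = wedge d p" by blast
    have "k < n" "l < n" using kl s by auto
    from wedge_basis[of n d e, OF d(3) p(1) this] show ?case
      using p kl unfolding Z_def by auto
  qed
  have b_apply: "b x y = (\<Sum>i<s. wedge d (2 * s - 1 - i, i) x y)" for x y
    unfolding b_def by (rule sum_form_apply)
  have b_eval: "b (e k) (e l) = (\<Sum>i<s. of_bool (2 * s - 1 - i = l \<and> i = k) - of_bool (2 * s - 1 - i = k \<and> i = l))"
    if "k < 2 * s" "l < 2 * s" for k l
    unfolding b_apply
  proof (rule sum.cong[OF refl])
    fix i assume i: "i \<in> {..<s}"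
    have "(2 * s - 1 - i, i) \<in> ?P" "k < n" "l < n" using i that s by auto
    from wedge_basis[of n d e, OF d(3) this]
    show "wedge d (2 * s - 1 - i, i) (e k) (e l)
      = of_bool (2 * s - 1 - i = l \<and> i = k) - of_bool (2 * s - 1 - i = k \<and> i = l)" by simp
  qed
  have b0: "b (e k) (e l) = 0" if "k < 2 * s" "l < 2 * s" "2 * s - 1 < k + l" for k l
    unfolding b_eval[OF that(1,2)] using that by (intro sum.neutral) auto
  have b1: "b (e k) (e (2 * s - 1 - k)) = 1" if k: "k < s" for k
  proof -
    have kl: "k < 2 * s" "2 * s - 1 - k < 2 * s" using k by auto
    have "b (e k) (e (2 * s - 1 - k)) = (\<Sum>i<s. if i = k then 1 else 0)"
      unfolding b_eval[OF kl]
    proof (rule sum.cong[OF refl])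
      fix i assume "i \<in> {..<s}"
      then have "(2 * s - 1 - i = 2 * s - 1 - k \<and> i = k) = (i = k)"
        "\<not> (2 * s - 1 - i = k \<and> i = 2 * s - 1 - k)" using k by auto
      then show "of_bool (2 * s - 1 - i = 2 * s - 1 - k \<and> i = k)
        - of_bool (2 * s - 1 - i = k \<and> i = 2 * s - 1 - k) = (if i = k then 1 else 0 :: 'a)"
        by (simp only: of_bool_def if_False diff_zero)
    qed
    also have "\<dots> = 1" using k by simp
    finally show ?thesis .
  qed
  have b_anti: "b (e k) (e (2 * s - 1 - k)) \<noteq> 0" if k: "k < 2 * s" for k
  proof (cases "k < s")
    case True
    then show ?thesis using b1 by simp
  next
    case False
    then have "b (e (2 * s - 1 - k)) (e k) = 1" using b1[of "2 * s - 1 - k"] k by simp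
    then show ?thesis using alt_swap[OF b, of "e k"] by simp
  qed
  have rank: "dim {x. \<forall>y. (b + w) x y = 0} + 2 * s \<le> n" if w: "w \<in> W" for w
  proof -
    let ?c = "b + w"
    have c: "?c \<in> alt_forms scale" using b w W by (blast intro: alt_forms_add)
    define R where "R = {x. \<forall>y. ?c x y = 0}"
    have R: "subspace R" using subspace_left_orthogonal[OF c, of UNIV] by (simp add: R_def)
    \<comment> \<open>The projection \<open>g\<close> forgets the leading block; its injectivity on
      the radical is the claim.\<close>
    define g where "g = (\<lambda>x. \<Sum>k\<in>{2 * s..<n}. scale (d k x) (e k))"
    interpret pp: finite_dimensional_vector_space_pair_1 scale Basis scale
      by unfold_locales
    interpret g: linear scale scale g
      unfolding g_def
      by unfold_locales (simp_all add: d(1,2) scale_left_distrib sum.distrib scale_sum_right)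
    have ker: "x = 0" if x: "x \<in> R" and gx: "g x = 0" for x
    proof -
      have "x = (\<Sum>k\<in>{..<2 * s}. scale (d k x) (e k)) + g x"
        unfolding g_def using d(4)[of x] s
        by (metis (no_types, lifting) atLeast0LessThan le0 sum.atLeastLessThan_concat)
      then have xs: "x = (\<Sum>k\<in>{..<2 * s}. scale (d k x) (e k))" using gx by simp
      \<comment> \<open>Pair \<open>x\<close> with \<open>e (2 * s - 1 - i)\<close>: coordinates
        before \<open>i\<close> vanish by induction, those after \<open>i\<close> meet entries below
        the antidiagonal, and coordinate \<open>i\<close> meets an antidiagonal entry, which is
        nonzero.\<close>
      have "d k x = 0" if "k < 2 * s" for k
        using that
      proof (induction k rule: less_induct)
        case (less i)
        let ?l = "2 * s - 1 - i"
        have "0 = ?c x (e ?l)" using x by (simp add: R_def)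
        also have "\<dots> = (\<Sum>k\<in>{..<2 * s}. d k x * ?c (e k) (e ?l))"
          by (subst (1) xs) (simp only: alt_sum_left[OF c] alt_scale_left[OF c])
        also have "\<dots> = (\<Sum>k\<in>{i}. d k x * ?c (e k) (e ?l))"
        proof (rule sum.mono_neutral_right)
          show "\<forall>k\<in>{..<2 * s} - {i}. d k x * ?c (e k) (e ?l) = 0"
          proof
            fix k assume k: "k \<in> {..<2 * s} - {i}"
            show "d k x * ?c (e k) (e ?l) = 0"
            proof (cases "k < i")
              case True
              then show ?thesis using less k by simp
            next
              case False
              then have "k < 2 * s" "?l < 2 * s" "2 * s - 1 < k + ?l" using k less.prems by auto
              then show ?thesis using b0[of k ?l] W0[OF w, of k ?l] by simp
            qed
          qed
        qed (use less.prems in auto)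
        also have "\<dots> = d i x * b (e i) (e ?l)"
          using W0[OF w, of i ?l] less.prems by simp
        finally show ?case using b_anti[OF less.prems] by simp
      qed
      then show ?thesis by (subst xs) simp
    qed
    have spR: "span R = R" using R by (rule iffD2[OF span_eq_iff])
    have "inj_on g (span R)"
      unfolding spR g.inj_on_iff_eq_0[OF R] using ker by blast
    then have "dim R = dim (g ` R)" using pp.dim_image_eq[OF g.linear_axioms] by simp
    also have "g ` R \<subseteq> span (e ` {2 * s..<n})"
      unfolding g_def by (intro image_subsetI span_sum span_scale span_base) blast
    then have "dim (g ` R) \<le> card (e ` {2 * s..<n})" by (rule dim_le_card) simp
    also have "\<dots> \<le> n - 2 * s" using card_image_le[of "{2 * s..<n}" e] by simp
    finally show ?thesis using s unfolding R_def by linarith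
  qed
  have "forms.subspace W" unfolding W_def by (rule forms.subspace_span)
  then show ?thesis using b W dimW rank by (intro exI[of _ b] exI[of _ W]) simp
qed

end

theorem theorem4:
  fixes scale :: "'a::field \<Rightarrow> 'v::ab_group_add \<Rightarrow> 'v"
    and Basis :: "'v set" and n r s :: nat
  assumes "finite_dimensional_vector_space scale Basis"
    and "vector_space.dim scale (UNIV :: 'v set) = n"
    and "r = 2 * s" and "r \<le> n"
    and "even n \<Longrightarrow> infinite (UNIV :: 'a set) \<or> n - 1 \<le> card (UNIV :: 'a set)"
    and "odd n \<Longrightarrow> infinite (UNIV :: 'a set) \<or> n - 2 \<le> card (UNIV :: 'a set)"
  shows "d_rank_ge scale r = s * (s - 1) + r * (n - r) + (n - r) * (n - r - 1) div 2
       \<and> d_rank_ge scale r = vector_space.dim form_scale (alt_forms scale) - s ^ 2"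
proof -
  interpret V: finite_dimensional_vector_space scale Basis by fact
  have n: "V.dim UNIV = n" by (rule assms(2))
  \<comment> \<open>The upper bound asks for \<open>n div 2\<close> scalars, and both parity cases
    supply them. The value of \<open>card\<close> on an infinite type is \<open>0\<close>, hence the
    separate disjunct.\<close>
  have field_card: "infinite (UNIV :: 'a set) \<or> n div 2 \<le> card (UNIV :: 'a set)"
  proof (cases "even n")
    case True
    then have "n div 2 \<le> n - 1" by presburger
    then show ?thesis using assms(5)[OF True] by linarith
  next
    case False
    then have "n div 2 \<le> n - 2 \<or> n = 1" by presburger
    then show ?thesis using assms(6)[OF False] by auto
  qed
  have dim_le: "V.dim X \<le> n" for X 
    unfolding n[symmetric] by (rule V.dim_subset[OF subset_UNIV])
  \<comment> \<open>The radical has dimension at most \<open>n\<close>, so the truncated subtraction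
    in \<open>form_rank\<close> is exact and the condition can be written additively.\<close>
  have rank: "r \<le> form_rank scale b \<longleftrightarrow> V.dim {x. \<forall>y. b x y = 0} + 2 * s \<le> n" for b
    using dim_le[of "{x. \<forall>y. b x y = 0}"] assms(3,4) unfolding form_rank_def n by linarith
  have "d_rank_ge scale r = n * (n - 1) div 2 - s\<^sup>2"
    unfolding d_rank_ge_def
  proof (rule Greatest_equality)
    have "2 * s \<le> n" using assms(3,4) by simp
    from V.rank_construction[OF n this]
    show "\<exists>b0 W. b0 \<in> alt_forms scale \<and> W \<subseteq> alt_forms scale \<and> forms.subspace W \<and>
      forms.dim W = n * (n - 1) div 2 - s\<^sup>2 \<and> (\<forall>b\<in>affine_translate b0 W. r \<le> form_rank scale b)"
      unfolding affine_translate_def rank ball_simps .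
  next
    fix k
    assume "\<exists>b0 W. b0 \<in> alt_forms scale \<and> W \<subseteq> alt_forms scale \<and> forms.subspace W \<and>
      forms.dim W = k \<and> (\<forall>b\<in>affine_translate b0 W. r \<le> form_rank scale b)"
    then obtain b0 W where b0: "b0 \<in> alt_forms scale" and W: "W \<subseteq> alt_forms scale" "forms.subspace W"
      "forms.dim W = k" and b0W: "\<And>w. w \<in> W \<Longrightarrow> V.dim {x. \<forall>y. (b0 + w) x y = 0} + 2 * s \<le> n"
      unfolding affine_translate_def rank ball_simps by blast
    have "V.dim {x \<in> UNIV. \<forall>y\<in>UNIV. (b0 + w) x y = 0} + 2 * s \<le> n" if "w \<in> W" for w
      using b0W[OF that] by simp
    from V.rank_bound[OF V.subspace_UNIV n W(2,1) b0 this field_card]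
    obtain C where C: "finite C" "card C + s\<^sup>2 \<le> n * (n - 1) div 2"
      "W \<subseteq> forms.span (C \<union> {w \<in> W. \<forall>p\<in>UNIV. \<forall>q\<in>UNIV. w p q = 0})" by blast
    have "forms.dim W \<le> card C"
      by (rule forms.dim_le_card[OF order.trans[OF C(3) span_Un_vanishing] C(1)])
    then show "k \<le> n * (n - 1) div 2 - s\<^sup>2" using W(3) C(2) by linarith
  qed
  moreover have "s * (s - 1) + r * (n - r) + (n - r) * (n - r - 1) div 2 = n * (n - 1) div 2 - s\<^sup>2"
    using nat_triangle_minus_square[of s n] assms(3,4) by simp
  ultimately show ?thesis using V.dim_alt_forms[OF n field_card] by simp
qed

end
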